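(* Let $p$ be a prime with $p\ne2$ and let $1\le q,q'<p$. If there is a homotopy equivalence of lens spaces $L(p,q)\to L(p,q')$, then $$q\cdot q'\equiv\pm n^2\mod p\quad\text{for some } n\in\mathbb Z_p-\{0\}.$$
   Context: $L(p,q)$ denotes the standard $3$-dimensional lens space, and $\mathbb Z_p=\mathbb Z/p\mathbb Z$. *)

theory Defs
  imports "HOL-Analysis.Analysis" "HOL-Number_Theory.Cong"
begin

definition quotient_topology :: "'a topology \<Rightarrow> ('a \<Rightarrow> 'b) \<Rightarrow> 'b topology" where
  "quotient_topology X f =
     topology (\<lambda>U. U \<subseteq> f ` topspace X \<and> openin X {x \<in> topspace X. f x \<in> U})"

lemma openin_quotient_topology:
  "openin (quotient_topology X f) U \<longleftrightarrow>
     U \<subseteq> f ` topspace X \<and> openin X {x \<in> topspace X. f x \<in> U}"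
proof -
  have "istopology (\<lambda>U. U \<subseteq> f ` topspace X \<and> openin X {x \<in> topspace X. f x \<in> U})"
    unfolding istopology_def
  proof (intro conjI allI impI)
    fix S T
    assume S: "S \<subseteq> f ` topspace X \<and> openin X {x \<in> topspace X. f x \<in> S}"
      and T: "T \<subseteq> f ` topspace X \<and> openin X {x \<in> topspace X. f x \<in> T}"
    show "S \<inter> T \<subseteq> f ` topspace X"
      using S by blast
    have "{x \<in> topspace X. f x \<in> S \<inter> T} =
        {x \<in> topspace X. f x \<in> S} \<inter> {x \<in> topspace X. f x \<in> T}"
      by blast
    then show "openin X {x \<in> topspace X. f x \<in> S \<inter> T}"
      using S T by auto
  next
    fix \<K>
    assume K: "\<forall>K\<in>\<K>. K \<subseteq> f ` topspace X \<and> openin X {x \<in> topspace X. f x \<in> K}"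
    show "\<Union>\<K> \<subseteq> f ` topspace X"
      using K by blast
    have "{x \<in> topspace X. f x \<in> \<Union>\<K>} = (\<Union>K\<in>\<K>. {x \<in> topspace X. f x \<in> K})"
      by blast
    then show "openin X {x \<in> topspace X. f x \<in> \<Union>\<K>}"
      using K by auto
  qed
  then show ?thesis
    by (simp add: quotient_topology_def)
qed

lemma topspace_quotient_topology: "topspace (quotient_topology X f) = f ` topspace X"
proof -
  have "{x \<in> topspace X. f x \<in> f ` topspace X} = topspace X"
    by blast
  then have "openin (quotient_topology X f) (f ` topspace X)"
    by (simp add: openin_quotient_topology)
  then show ?thesis
    by (meson openin_quotient_topology openin_subset openin_topspace subset_antisym)
qed

lemma quotient_map_quotient_topology: "quotient_map X (quotient_topology X f) f"
  by (auto simp: quotient_map_def topspace_quotient_topology openin_quotient_topology)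

text \<open>
  With \<open>\<zeta> = cis (2 * pi / p)\<close>, the class of \<open>k\<close> in \<open>\<int>/p\<int>\<close> acts on the unit sphere of
  \<open>\<complex>\<^sup>2\<close> by \<open>(z, w) \<mapsto> (\<zeta>\<^sup>k z, \<zeta>\<^sup>q\<^sup>k w)\<close>. The exponent \<open>k\<close> ranges over all
  integers; the result depends only on \<open>k\<close> modulo \<open>p\<close>.
\<close>
definition lens_action :: "nat \<Rightarrow> nat \<Rightarrow> int \<Rightarrow> complex \<times> complex \<Rightarrow> complex \<times> complex" where
  "lens_action p q k = (\<lambda>(z, w).
     (cis (2 * pi / real p) powi k * z, cis (2 * pi / real p) powi (int q * k) * w))"

definition lens_orbit :: "nat \<Rightarrow> nat \<Rightarrow> complex \<times> complex \<Rightarrow> (complex \<times> complex) set" where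
  "lens_orbit p q x = range (\<lambda>k. lens_action p q k x)"

text \<open>
  The points of \<open>L(p,q)\<close> are the orbits. This is the usual lens space only when \<open>0 < p\<close> and
  \<open>coprime p q\<close>, which makes the action free. The norm on the product type is the Euclidean
  one, so \<open>sphere 0 1\<close> is the 3-sphere.
\<close>
definition lens_space :: "nat \<Rightarrow> nat \<Rightarrow> (complex \<times> complex) set topology" where
  "lens_space p q =
     quotient_topology (top_of_set (sphere (0 :: complex \<times> complex) 1)) (lens_orbit p q)"

lemma lens_action_0: "lens_action p q 0 x = x"
  by (simp add: lens_action_def split: prod.split)

lemma lens_action_add: "lens_action p q (j + k) x = lens_action p q j (lens_action p q k x)"
  by (simp add: lens_action_def power_int_add distrib_left mult_ac split: prod.split)

lemma lens_action_period:
  assumes "0 < p"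
  shows "lens_action p q (k + int p) x = lens_action p q k x"
proof -
  have "cis (2 * pi / real p) powi int p = 1"
    using assms by (simp only: power_int_of_nat Complex.DeMoivre) simp
  then show ?thesis
    by (simp add: lens_action_def power_int_add distrib_left power_int_mult mult.commute[of "int q" "int p"]
        split: prod.split)
qed

lemma norm_lens_action: "norm (lens_action p q k x) = norm x"
  by (simp add: lens_action_def norm_prod_def norm_mult norm_power_int split: prod.split)

lemma lens_orbit_eq_iff: "lens_orbit p q x = lens_orbit p q y \<longleftrightarrow> (\<exists>k. y = lens_action p q k x)"
proof
  assume "lens_orbit p q x = lens_orbit p q y"
  moreover have "y \<in> lens_orbit p q y"
    unfolding lens_orbit_def by (metis lens_action_0 rangeI)
  ultimately show "\<exists>k. y = lens_action p q k x"
    unfolding lens_orbit_def by blast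
next
  assume "\<exists>k. y = lens_action p q k x"
  then obtain k where y: "y = lens_action p q k x" ..
  have "lens_action p q j y = lens_action p q (j + k) x"
    and "lens_action p q j x = lens_action p q (j - k) y" for j
    using lens_action_add[of p q _ k x] by (simp_all add: y flip: lens_action_add)
  then show "lens_orbit p q x = lens_orbit p q y"
    unfolding lens_orbit_def by (metis (no_types, lifting) image_cong image_subset_iff rangeI subset_antisym)
qed

end

theory Submission
  imports Defs "HOL-Homology.Homology"
begin

text \<open>
  Lift the homotopy equivalence to a map \<open>F\<close> of the 3-sphere. It has degree \<open>\<plusminus>1\<close>, and it
  intertwines the generator \<open>t\<close> of the first action with a power \<open>t'\<^sup>a\<close> of the generator of the
  second. Singular chains turn a periodic self-map \<open>s\<close> of the sphere into an invariant in
  \<open>H\<^sub>3 / p\<close>: with \<open>N = 1 + s + \<dots> + s\<^sup>p\<^sup>-\<^sup>1\<close>, choose in turn chains with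
  \<open>\<partial>c\<^sub>1 = s c\<^sub>0 - c\<^sub>0\<close>, \<open>\<partial>c\<^sub>2 = N c\<^sub>1\<close> and \<open>\<partial>c\<^sub>3 = s c\<^sub>2 - c\<^sub>2\<close>; the class of the cycle \<open>N c\<^sub>3\<close> is
  well defined modulo \<open>p\<close>. It is natural, replacing \<open>s\<close> by \<open>s\<^sup>a\<close> multiplies it by \<open>a\<^sup>2\<close>, and
  writing the sphere as a join of two circles subdivided into \<open>p\<close> arcs shows that for \<open>t\<close> it
  is \<open>q e\<close>, with the same class \<open>e\<close> for all \<open>q\<close>. Hence \<open>\<plusminus>q e = a\<^sup>2 q' e\<close> in \<open>H\<^sub>3 / p\<close>. Cutting the
  sphere along hyperplanes down to dimension \<open>0\<close> shows that \<open>e\<close> is not divisible by any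
  \<open>m > 1\<close>, so that \<open>a\<^sup>2 q' \<equiv> \<plusminus>q\<close> modulo \<open>p\<close>.
\<close>

section \<open>Lens spaces and their coverings\<close>

lemma cis_powi_eq_1_iff:
  assumes "0 < p"
  shows "cis (2 * pi / real p) powi k = 1 \<longleftrightarrow> int p dvd k"
proof
  assume "cis (2 * pi / real p) powi k = 1"
  then have "cos (of_int k * (2 * pi / real p)) = 1"
    by (simp add: cis_power_int complex_eq_iff)
  then obtain n :: int where "of_int k * (2 * pi / real p) = of_int n * 2 * pi"
    using cos_one_2pi_int by blast
  then have "real_of_int k = of_int (n * int p)"
    using assms by (simp add: field_simps)
  then show "int p dvd k"
    by (metis dvd_triv_right of_int_eq_iff)
next
  assume "int p dvd k"
  then obtain n where "k = int p * n" ..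
  then have "of_int k * (2 * pi / real p) = 2 * pi * real_of_int n"
    using assms by simp
  then show "cis (2 * pi / real p) powi k = 1"
    by (simp add: cis_power_int cis_multiple_2pi)
qed

lemma lens_action_mod:
  assumes "0 < p"
  shows "lens_action p q (k mod int p) x = lens_action p q k x"
proof -
  have 0: "lens_action p q (j + int p * int n) y = lens_action p q j y" for j n y
    by (induction n) (use assms lens_action_period[of p q] in \<open>simp_all add: distrib_left flip: add.assoc\<close>,
      metis (no_types, opaque_lifting) add.commute add.left_commute)
  have "lens_action p q (j + int p * i) y = lens_action p q j y" for j i y
  proof (cases "i \<ge> 0")
    case True
    then show ?thesis using 0[of j "nat i"] by simp
  next
    case False
    then show ?thesis using 0[of "j + int p * i" "nat (-i)"] by simp
  qed
  from this[of "k mod int p" "k div int p"] show ?thesis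
    by simp
qed

text \<open>Some coordinate of \<open>x\<close> is nonzero; there the fixed-point equation says that
  \<open>p\<close> divides \<open>k\<close> or \<open>q * k\<close>, and by coprimality the two mean
  the same.\<close>

lemma lens_action_eq_self_iff:
  assumes "coprime p q" "0 < p" "x \<noteq> 0"
  shows "lens_action p q k x = x \<longleftrightarrow> int p dvd k"
proof -
  have "int p dvd int q * k \<longleftrightarrow> int p dvd k"
    using assms by (simp add: coprime_dvd_mult_right_iff)
  then show ?thesis
    using assms by (cases x) (auto simp: lens_action_def cis_powi_eq_1_iff zero_prod_def)
qed

lemma continuous_on_lens_action: "continuous_on A (lens_action p q k)"
  unfolding lens_action_def case_prod_unfold by (intro continuous_intros)

lemma dist_lens_action: "dist (lens_action p q k x) (lens_action p q k y) = dist x y"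
proof -
  have "lens_action p q k x - lens_action p q k y = lens_action p q k (x - y)"
    by (simp add: lens_action_def case_prod_unfold minus_prod_def algebra_simps)
  then show ?thesis
    by (simp add: dist_norm norm_lens_action)
qed

text \<open>
  These invariants of the action separate the orbits, so they realise the lens space as a
  subset of a Euclidean space, where the library's theory of covering spaces applies.
\<close>
definition lens_invariants :: "nat \<Rightarrow> nat \<Rightarrow> complex \<times> complex \<Rightarrow> complex \<times> complex \<times> complex" where
  "lens_invariants p q = (\<lambda>(z, w). (z ^ p, z ^ (p - q) * w, w ^ p))"

section \<open>The covering of the space of invariants by the 3-sphere\<close>

lemma continuous_on_lens_invariants: "continuous_on A (lens_invariants p q)"
  unfolding lens_invariants_def case_prod_unfold by (intro continuous_intros)

text \<open>The mixed monomial picks up the root of unity to the exponent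
  \<open>k * (p - q) + q * k = p * k\<close>; \<open>q \<le> p\<close> keeps the subtraction of
  naturals exact.\<close>

lemma lens_invariants_lens_action:
  assumes "0 < p" "q \<le> p"
  shows "lens_invariants p q (lens_action p q k x) = lens_invariants p q x"
proof -
  let ?c = "cis (2 * pi / real p)"
  have p: "(?c powi j) ^ p = 1" for j
    using cis_powi_eq_1_iff[OF assms(1), of "j * int p"] by (simp add: power_int_mult)
  have "(?c powi k) ^ (p - q) * ?c powi (int q * k) = ?c powi (k * int (p - q) + int q * k)"
    by (simp add: power_int_mult power_int_add)
  also have "k * int (p - q) + int q * k = int p * k"
    using assms by (simp add: of_nat_diff algebra_simps)
  also have "?c powi (int p * k) = 1"
    using cis_powi_eq_1_iff[OF assms(1)] by simp
  finally have "(?c powi k) ^ (p - q) * ?c powi (int q * k) = 1" .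
  then have "(?c powi k * z) ^ (p - q) * (?c powi (int q * k) * w) = z ^ (p - q) * w" for z w
    by (simp add: power_mult_distrib mult_ac flip: mult.assoc)
  then show ?thesis
    by (simp add: lens_invariants_def lens_action_def case_prod_unfold power_mult_distrib p)
qed

lemma root_of_unity_eq:
  fixes y z :: complex
  assumes "0 < p" "z ^ p = y ^ p"
  obtains k where "y = cis (2 * pi / real p) powi k * z"
proof (cases "z = 0")
  case True
  then have "y = 0"
    using assms by (metis power_0_left power_eq_0_iff less_numeral_extra(3))
  then show ?thesis
    using True that by simp
next
  case False
  then have "(y / z) ^ p = 1"
    using assms by (metis div_self power_divide power_not_zero)
  then obtain j where "y / z = cis (2 * pi * real j / real p)"
    using Complex.bij_betw_roots_unity[OF assms(1)] by (auto simp: bij_betw_def image_def set_eq_iff)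
  moreover have "cis (2 * pi * real j / real p) = cis (2 * pi / real p) powi int j"
    by (simp only: cis_power_int) (simp add: mult_ac)
  ultimately show ?thesis
    using False that[of "int j"] by (simp add: field_simps)
qed

text \<open>If \<open>z\<close> is nonzero, the first monomial gives \<open>k\<close> and the mixed
  one then determines the second coordinate. If \<open>z = 0\<close>, the mixed one carries no
  information; the last monomial gives a power \<open>j\<close>, which an inverse of
  \<open>q\<close> modulo \<open>p\<close> turns into an exponent of the action.\<close>

lemma lens_invariants_eq_iff:
  assumes "prime p" "1 \<le> q" "q < p"
  shows "lens_invariants p q x = lens_invariants p q y \<longleftrightarrow> (\<exists>k. y = lens_action p q k x)"
proof
  have p: "0 < p" using assms by simp
  let ?c = "cis (2 * pi / real p)"
  obtain z w z' w' where xy: "x = (z, w)" "y = (z', w')"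
    by fastforce
  assume "lens_invariants p q x = lens_invariants p q y"
  then have eq: "z ^ p = z' ^ p" "z ^ (p - q) * w = z' ^ (p - q) * w'" "w ^ p = w' ^ p"
    by (auto simp: xy lens_invariants_def)
  obtain k where k: "z' = ?c powi k * z"
    using root_of_unity_eq[OF p eq(1)] by blast
  show "\<exists>k. y = lens_action p q k x"
  proof (cases "z = 0")
    case False
    have "lens_invariants p q (lens_action p q k x) = lens_invariants p q x"
      using assms by (intro lens_invariants_lens_action) auto
    then have "z' ^ (p - q) * (?c powi (int q * k) * w) = z ^ (p - q) * w"
      by (simp add: xy lens_invariants_def lens_action_def k)
    moreover have "z' \<noteq> 0"
      using k False by simp
    ultimately have "w' = ?c powi (int q * k) * w"
      using eq(2) by simp
    then show ?thesis
      using k by (auto simp: xy lens_action_def)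
  next
    case True
    obtain j where j: "w' = ?c powi j * w"
      using root_of_unity_eq[OF p eq(3)] by blast
    have "coprime (int q) (int p)"
      using assms by (metis coprime_int_iff coprime_commute prime_imp_coprime nat_dvd_not_less less_le_trans zero_less_one)
    then obtain i where i: "[int q * i = 1] (mod int p)"
      using cong_solve_coprime_int by blast
    then have "[int q * (i * j) = j] (mod int p)"
      by (metis cong_scalar_right mult.assoc mult_1)
    then have "int p dvd int q * (i * j) - j"
      by (simp add: cong_iff_dvd_diff)
    then have "?c powi (int q * (i * j) - j) = 1"
      using p by (simp add: cis_powi_eq_1_iff)
    then have "?c powi (int q * (i * j)) = ?c powi j"
      by (simp add: power_int_diff)
    then have "y = lens_action p q (i * j) x"
      using True k j by (simp add: xy lens_action_def)
    then show ?thesis ..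
  qed
next
  assume "\<exists>k. y = lens_action p q k x"
  then show "lens_invariants p q x = lens_invariants p q y"
    using assms by (auto simp: lens_invariants_lens_action)
qed

lemma homeomorphism_lens_action:
  "homeomorphism (sphere 0 1) (sphere 0 1) (lens_action p q k) (lens_action p q (- k))"
  by (rule homeomorphismI)
    (auto simp: norm_lens_action continuous_on_lens_action lens_action_0 simp flip: lens_action_add)

text \<open>The saturation of \<open>W\<close> is the union of its translates, which are open
  because the action is by homeomorphisms. Compactness of the sphere makes the invariants a quotient
  map onto their image.\<close>

lemma openin_lens_invariants_image:
  assumes "prime p" "1 \<le> q" "q < p" and W: "openin (top_of_set (sphere 0 1)) W"
  shows "openin (top_of_set (lens_invariants p q ` sphere 0 1)) (lens_invariants p q ` W)"
proof -
  let ?S = "sphere (0 :: complex \<times> complex) 1" and ?\<phi> = "lens_invariants p q"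
  have sub: "W \<subseteq> ?S"
    using W openin_imp_subset by blast
  have "openin (top_of_set ?S) (lens_action p q k ` W)" for k
    using homeomorphism_imp_open_map[OF homeomorphism_lens_action W] .
  moreover have "?S \<inter> ?\<phi> -` (?\<phi> ` W) = (\<Union>k. lens_action p q k ` W)"
  proof (intro equalityI subsetI)
    fix y assume "y \<in> ?S \<inter> ?\<phi> -` (?\<phi> ` W)"
    then obtain x where "x \<in> W" "?\<phi> x = ?\<phi> y"
      by auto
    then show "y \<in> (\<Union>k. lens_action p q k ` W)"
      using lens_invariants_eq_iff[OF assms(1-3)] by auto
  next
    fix y assume "y \<in> (\<Union>k. lens_action p q k ` W)"
    then obtain k x where "x \<in> W" "y = lens_action p q k x"
      by auto
    then show "y \<in> ?S \<inter> ?\<phi> -` (?\<phi> ` W)"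
      using sub assms by (auto simp: norm_lens_action lens_invariants_lens_action)
  qed
  ultimately have "openin (top_of_set ?S) (?S \<inter> ?\<phi> -` (?\<phi> ` W))"
    by auto
  then show ?thesis
    using sub by (subst (asm) Abstract_Topology_2.continuous_imp_quotient_map)
      (auto simp: continuous_on_lens_invariants)
qed

lemma covering_space_lens_invariants:
  assumes p: "prime p" "1 \<le> q" "q < p"
  shows "covering_space (sphere 0 1) (lens_invariants p q) (lens_invariants p q ` sphere 0 1)"
proof
  let ?S = "sphere (0 :: complex \<times> complex) 1" and ?\<phi> = "lens_invariants p q"
  let ?A = "lens_action p q"
  show "continuous_on ?S ?\<phi>"
    by (rule continuous_on_lens_invariants)
  fix y assume "y \<in> ?\<phi> ` ?S"
  then obtain x where x: "x \<in> ?S" "y = ?\<phi> x"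
    by blast
  have p0: "0 < p" and cop: "coprime p q"
    using p by (auto intro!: prime_imp_coprime dest: dvd_imp_le)
  have ne: "?A k x \<noteq> x" if "k \<in> {1..<int p}" for k
  proof -
    have "x \<noteq> 0"
      using x by auto
    then show ?thesis
      using that lens_action_eq_self_iff[OF cop p0] zdvd_not_zless by auto
  qed
  \<comment> \<open>Half the least distance from \<open>x\<close> to another point of its orbit, so
    that balls of radius \<open>r\<close> about distinct orbit points are disjoint.\<close>
  define r where "r = (if p = 1 then 1 else Min ((\<lambda>k. dist (?A k x) x) ` {1..<int p})) / 2"
  have "p \<noteq> 1" using p by auto
  have r: "0 < r" and rle: "\<And>k. k \<in> {1..<int p} \<Longrightarrow> 2 * r \<le> dist (?A k x) x"
    using ne \<open>p \<noteq> 1\<close> p0 by (auto simp: r_def)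
  \<comment> \<open>The action is isometric, so the distance between two translates of
    \<open>x\<close> is the distance from \<open>x\<close> to a single translate.\<close>
  have far: "int p dvd i - j" if "dist (?A i x) (?A j x) < 2 * r" for i j
  proof -
    have "dist (?A ((i - j) mod int p) x) x = dist (?A i x) (?A j x)"
      using dist_lens_action[of p q j "?A (i - j) x" x] lens_action_add[of p q j "i - j" x]
      by (simp add: lens_action_mod p0)
    then have "(i - j) mod int p \<notin> {1..<int p}"
      using rle that by force
    then have "(i - j) mod int p = 0"
      using p0 by (auto simp: not_less order_class.order.antisym)
    then show ?thesis
      by (simp add: dvd_eq_mod_eq_0)
  qed
  \<comment> \<open>The sheets over a neighbourhood of \<open>y\<close> are the translates of one
    cap. Indices congruent modulo \<open>p\<close> give the same sheet, so disjointness is shown for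
    distinct sets, not for distinct indices.\<close>
  define U where "U = (\<lambda>k. ?S \<inter> ball (?A k x) r)"
  have AU: "?A k ` U j = U (k + j)" for k j
  proof -
    have sub: "?A k ` U j \<subseteq> U (k + j)" for k j
      by (auto simp: U_def norm_lens_action lens_action_add dist_lens_action)
    show ?thesis
    proof (intro equalityI sub subsetI)
      fix y assume "y \<in> U (k + j)"
      then have "?A (- k) y \<in> U j"
        using sub[of "- k" "k + j"] by auto
      moreover have "y = ?A k (?A (- k) y)"
        by (simp add: lens_action_0 flip: lens_action_add)
      ultimately show "y \<in> ?A k ` U j"
        by blast
    qed
  qed
  have \<phi>U: "?\<phi> ` U k = ?\<phi> ` U 0" for k
  proof -
    have "?\<phi> ` U k = ?\<phi> ` (?A k ` U 0)"
      by (simp add: AU)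
    also have "\<dots> = ?\<phi> ` U 0"
      using p by (simp add: image_comp o_def lens_invariants_lens_action)
    finally show ?thesis .
  qed
  have opU: "openin (top_of_set ?S) (U k)" for k
    by (simp add: U_def openin_open_Int)
  have opT: "openin (top_of_set (?\<phi> ` ?S)) (?\<phi> ` U 0)"
    by (rule openin_lens_invariants_image[OF p opU])
  have same: "U i = U j" if "U i \<inter> U j \<noteq> {}" for i j
  proof -
    obtain w where w: "w \<in> U i" "w \<in> U j"
      using \<open>U i \<inter> U j \<noteq> {}\<close> by auto
    have "dist (?A i x) (?A j x) < 2 * r"
      using w dist_triangle2[of "?A i x" "?A j x" w] by (auto simp: U_def)
    then have "(i - j) mod int p = 0"
      using far by auto
    then have "i mod int p = j mod int p"
      by (metis mod_eq_dvd_iff dvd_eq_mod_eq_0)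
    then have "?A i x = ?A j x"
      by (metis lens_action_mod p0)
    then show ?thesis
      by (simp add: U_def)
  qed
  \<comment> \<open>If \<open>b\<close> is the translate of \<open>a\<close> by \<open>j\<close>,
    then \<open>b\<close> is within \<open>r\<close> of the centres of the sheets \<open>k\<close>
    and \<open>j + k\<close>; hence \<open>p\<close> divides \<open>j\<close>.\<close>
  have inj: "inj_on ?\<phi> (U k)" for k
  proof
    fix a b assume ab: "a \<in> U k" "b \<in> U k" "?\<phi> a = ?\<phi> b"
    then obtain j where j: "b = ?A j a"
      using lens_invariants_eq_iff[OF p] by blast
    have "b \<in> U (j + k)"
      using ab AU[of j k] j by auto
    then have "dist (?A (j + k) x) (?A k x) < 2 * r"
      using ab dist_triangle2[of "?A (j + k) x" "?A k x" b] by (auto simp: U_def)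
    then have "int p dvd j"
      using far[of "j + k" k] by simp
    then show "a = b"
      using lens_action_mod[OF p0, of q j a] j by (simp add: lens_action_0)
  qed
  have hom: "\<exists>g. homeomorphism (U k) (?\<phi> ` U 0) ?\<phi> g" for k
  proof (rule homeomorphism_injective_open_map)
    fix W assume "openin (top_of_set (U k)) W"
    then have "openin (top_of_set ?S) W" "W \<subseteq> U k"
      using opU openin_trans openin_imp_subset by blast+
    then show "openin (top_of_set (?\<phi> ` U 0)) (?\<phi> ` W)"
      using openin_lens_invariants_image[OF p] \<phi>U[of k] opT
      by (metis image_mono openin_imp_subset openin_subset_trans)
  qed (rule continuous_on_lens_invariants \<phi>U inj exI | assumption)+
  show "\<exists>T. y \<in> T \<and> openin (top_of_set (?\<phi> ` ?S)) T \<and>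
          (\<exists>v. \<Union>v = ?S \<inter> ?\<phi> -` T \<and> (\<forall>u\<in>v. openin (top_of_set ?S) u) \<and>
               pairwise disjnt v \<and> (\<forall>u\<in>v. \<exists>g. homeomorphism u T ?\<phi> g))"
  proof (intro exI conjI)
    show "y \<in> ?\<phi> ` U 0"
      using x r by (auto simp: U_def lens_action_0)
    show "\<Union> (range U) = ?S \<inter> ?\<phi> -` (?\<phi> ` U 0)"
    proof (intro equalityI subsetI)
      fix w assume "w \<in> \<Union> (range U)"
      then show "w \<in> ?S \<inter> ?\<phi> -` (?\<phi> ` U 0)"
        using \<phi>U unfolding U_def by blast
    next
      fix w assume "w \<in> ?S \<inter> ?\<phi> -` (?\<phi> ` U 0)"
      then obtain a where "a \<in> U 0" "?\<phi> a = ?\<phi> w"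
        by (metis IntD2 imageE vimageE)
      then obtain k where "a \<in> U 0" "w = ?A k a"
        using lens_invariants_eq_iff[OF p] by blast
      then have "w \<in> U k"
        using AU[of k 0] by auto
      then show "w \<in> \<Union> (range U)"
        by blast
    qed
    show "pairwise disjnt (range U)"
      using same by (auto simp: pairwise_def disjnt_def)
  qed (use opT opU hom in auto)
qed auto

section \<open>Homotopies and lifts of maps between lens spaces\<close>

lemma homotopic_lens_action_id:
  "homotopic_with_canon (\<lambda>x. True) (sphere 0 1) (sphere 0 1) (lens_action p q k) id"
proof -
  \<comment> \<open>Both rotation angles shrink linearly to 0.\<close>
  define h where "h = (\<lambda>(t, z, w). (cis ((1 - t) * (of_int k * (2 * pi / real p))) * z,
    cis ((1 - t) * (of_int (int q * k) * (2 * pi / real p))) * w) :: complex \<times> complex)"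
  show ?thesis
    unfolding homotopic_with_def
  proof (intro exI[of _ h] conjI allI ballI)
    have "continuous_on ({0..1} \<times> sphere 0 1) h"
      unfolding h_def case_prod_unfold cis_conv_exp by (intro continuous_intros)
    moreover have "h ` ({0..1} \<times> sphere 0 1) \<subseteq> sphere 0 1"
      by (auto simp: h_def norm_prod_def norm_mult)
    ultimately show "continuous_map (prod_topology (top_of_set {0..1}) (top_of_set (sphere 0 1)))
        (top_of_set (sphere 0 1)) h"
      by (simp add: image_subset_iff_funcset flip: subtopology_Times)
  qed (auto simp: h_def lens_action_def cis_power_int)
qed

text \<open>The invariants factor through the quotient map, and \<open>\<psi>\<close> separates
  orbits because they do. Lifting problems for maps into the lens space thus become lifting problems
  for the covering in Euclidean space.\<close>

lemma lens_space_invariants: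
  assumes p: "prime p" "1 \<le> q" "q < p"
  obtains \<psi> where
    "continuous_map (lens_space p q) (top_of_set (lens_invariants p q ` sphere 0 1)) \<psi>"
    "\<And>x. x \<in> sphere 0 1 \<Longrightarrow> \<psi> (lens_orbit p q x) = lens_invariants p q x"
    "\<And>x y. \<lbrakk>x \<in> sphere 0 1; y \<in> sphere 0 1; \<psi> (lens_orbit p q x) = \<psi> (lens_orbit p q y)\<rbrakk>
      \<Longrightarrow> lens_orbit p q x = lens_orbit p q y"
proof -
  let ?S = "sphere (0 :: complex \<times> complex) 1" and ?\<phi> = "lens_invariants p q"
  have "quotient_map (top_of_set ?S) (lens_space p q) (lens_orbit p q)"
    unfolding lens_space_def by (rule quotient_map_quotient_topology)
  moreover have "continuous_map (top_of_set ?S) (top_of_set (?\<phi> ` ?S)) ?\<phi>"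
    by (auto simp: continuous_on_lens_invariants)
  moreover have "?\<phi> x = ?\<phi> y \<longleftrightarrow> lens_orbit p q x = lens_orbit p q y" for x y
    by (simp add: lens_invariants_eq_iff[OF p] lens_orbit_eq_iff)
  ultimately obtain \<psi> where
    "continuous_map (lens_space p q) (top_of_set (?\<phi> ` ?S)) \<psi>"
    "\<And>x. x \<in> ?S \<Longrightarrow> \<psi> (lens_orbit p q x) = ?\<phi> x"
    using quotient_map_lift_exists[of "top_of_set ?S" "lens_space p q" "lens_orbit p q"
        "top_of_set (?\<phi> ` ?S)" ?\<phi>]
    by (metis topspace_euclidean_subtopology)
  then show thesis
    using that by (auto simp: lens_invariants_eq_iff[OF p] lens_orbit_eq_iff)
qed

text \<open>The 3-sphere is simply connected and locally path connected, so the map to the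
  invariants lifts through the covering; injectivity of \<open>\<psi>\<close> turns equal invariants
  back into equal orbits.\<close>

lemma lens_space_map_lift:
  assumes q: "prime p" "1 \<le> q" "q < p" and q': "1 \<le> q'" "q' < p"
    and f: "continuous_map (lens_space p q) (lens_space p q') f"
  obtains F where "continuous_on (sphere 0 1) F" "F \<in> sphere 0 1 \<rightarrow> sphere 0 1"
    "\<And>x. x \<in> sphere 0 1 \<Longrightarrow> lens_orbit p q' (F x) = f (lens_orbit p q x)"
proof -
  let ?S = "sphere (0 :: complex \<times> complex) 1"
  obtain \<psi> where \<psi>:
    "continuous_map (lens_space p q') (top_of_set (lens_invariants p q' ` ?S)) \<psi>"
    "\<And>x. x \<in> ?S \<Longrightarrow> \<psi> (lens_orbit p q' x) = lens_invariants p q' x"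
    "\<And>x y. \<lbrakk>x \<in> ?S; y \<in> ?S; \<psi> (lens_orbit p q' x) = \<psi> (lens_orbit p q' y)\<rbrakk>
      \<Longrightarrow> lens_orbit p q' x = lens_orbit p q' y"
    using lens_space_invariants[OF q(1) q'] by blast
  have \<pi>: "continuous_map (top_of_set ?S) (lens_space p q) (lens_orbit p q)"
    unfolding lens_space_def by (intro quotient_imp_continuous_map quotient_map_quotient_topology)
  have "continuous_map (top_of_set ?S) (top_of_set (lens_invariants p q' ` ?S)) (\<psi> \<circ> (f \<circ> lens_orbit p q))"
    by (intro continuous_map_compose[OF _ \<psi>(1)] continuous_map_compose[OF \<pi> f])
  then have cont: "continuous_on ?S (\<psi> \<circ> (f \<circ> lens_orbit p q))"
    and im: "\<psi> \<circ> (f \<circ> lens_orbit p q) \<in> ?S \<rightarrow> lens_invariants p q' ` ?S"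
    by auto
  have "simply_connected ?S" "locally path_connected ?S"
    by (simp_all add: simply_connected_sphere locally_path_connected_sphere)
  then obtain F where F: "continuous_on ?S F" "F \<in> ?S \<rightarrow> ?S"
    "\<And>x. x \<in> ?S \<Longrightarrow> lens_invariants p q' (F x) = (\<psi> \<circ> (f \<circ> lens_orbit p q)) x"
    using covering_space_lift[OF covering_space_lens_invariants[OF q(1) q'] _ _ cont im] by metis
  have "lens_orbit p q' (F x) = f (lens_orbit p q x)" if x: "x \<in> ?S" for x
  proof -
    have "f (lens_orbit p q x) \<in> topspace (lens_space p q')"
      using continuous_map_funspace[OF continuous_map_compose[OF \<pi> f]] x by auto
    then obtain y where y: "y \<in> ?S" "f (lens_orbit p q x) = lens_orbit p q' y"
      by (auto simp: lens_space_def topspace_quotient_topology)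
    have Fx: "F x \<in> ?S"
      using F(2) x by blast
    have "\<psi> (lens_orbit p q' (F x)) = \<psi> (lens_orbit p q' y)"
      using F(3)[OF x] \<psi>(2)[OF Fx] y by simp
    then show ?thesis
      using \<psi>(3)[OF Fx y(1)] y by simp
  qed
  with F that show thesis by blast
qed

text \<open>Two lifts of one map differ by a deck transformation: choose it so that they agree at
  one point, then use uniqueness of lifts on the connected sphere.\<close>

lemma lens_invariants_lift_unique:
  assumes q: "prime p" "1 \<le> q" "q < p"
    and F: "continuous_on (sphere 0 1) F" "F \<in> sphere 0 1 \<rightarrow> sphere 0 1"
    and G: "continuous_on (sphere 0 1) G" "G \<in> sphere 0 1 \<rightarrow> sphere 0 1"
    and eq: "\<And>x. x \<in> sphere 0 1 \<Longrightarrow> lens_invariants p q (F x) = lens_invariants p q (G x)"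
  shows "\<exists>k :: nat. \<forall>x \<in> sphere (0 :: complex \<times> complex) 1. G x = lens_action p q (int k) (F x)"
proof -
  let ?S = "sphere (0 :: complex \<times> complex) 1"
  have x0: "(1, 0) \<in> ?S"
    by (simp add: norm_prod_def)
  then obtain k where k: "G (1, 0) = lens_action p q k (F (1, 0))"
    using eq lens_invariants_eq_iff[OF q] by blast
  \<comment> \<open>Reducing modulo \<open>p\<close> gives a natural exponent, so that the deck
    transformation is an iterate of the generator.\<close>
  define n where "n = nat (k mod int p)"
  have p0: "0 < p" using q by simp
  then have "int n = k mod int p"
    by (simp add: n_def)
  then have n: "G (1, 0) = lens_action p q (int n) (F (1, 0))"
    by (simp add: k lens_action_mod p0)
  have cont: "continuous_on ?S (lens_action p q (int n) \<circ> F)" "continuous_on ?S (lens_invariants p q \<circ> G)"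
    by (intro continuous_on_compose F(1) G(1) continuous_on_lens_action continuous_on_lens_invariants)+
  have im: "lens_action p q (int n) \<circ> F \<in> ?S \<rightarrow> ?S" "lens_invariants p q \<circ> G \<in> ?S \<rightarrow> lens_invariants p q ` ?S"
    using F(2) G(2) unfolding Pi_iff by (simp_all add: norm_lens_action)
  have conn: "connected ?S"
    by (simp add: simply_connected_imp_connected simply_connected_sphere)
  have "G x = (lens_action p q (int n) \<circ> F) x" if x: "x \<in> ?S" for x
    using covering_space_lift_unique[OF covering_space_lens_invariants[OF q], of G "(1, 0)"
        "lens_action p q (int n) \<circ> F" ?S "lens_invariants p q \<circ> G" x] n cont im G conn x0 x q eq
    by (simp add: lens_invariants_lens_action)
  then show ?thesis
    by (intro exI[of _ n] ballI) simp
qed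

text \<open>\<open>F\<close> and \<open>G\<close> lift the two maps of the equivalence. Precomposing
  \<open>F\<close> with the generator gives another lift of the same map, whence the exponent
  \<open>a\<close>. The homotopy from \<open>f \<circ> g\<close> to \<open>id\<close> lifts to one
  from \<open>F \<circ> G\<close> to a deck transformation, which is itself homotopic to the
  identity.\<close>

lemma lens_space_homotopy_equivalence_lift:
  assumes q: "prime p" "1 \<le> q" "q < p" and q': "1 \<le> q'" "q' < p"
    and he: "lens_space p q homotopy_equivalent_space lens_space p q'"
  obtains F G and a :: nat where
    "continuous_map (top_of_set (sphere 0 1)) (top_of_set (sphere 0 1)) F"
    "continuous_map (top_of_set (sphere 0 1)) (top_of_set (sphere 0 1)) G"
    "\<And>x. x \<in> sphere 0 1 \<Longrightarrow> F (lens_action p q 1 x) = lens_action p q' (int a) (F x)"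
    "homotopic_with_canon (\<lambda>x. True) (sphere 0 1) (sphere 0 1) (F \<circ> G) id"
proof -
  let ?S = "sphere (0 :: complex \<times> complex) 1"
  obtain f g where f: "continuous_map (lens_space p q) (lens_space p q') f"
    and g: "continuous_map (lens_space p q') (lens_space p q) g"
    and fg: "homotopic_with (\<lambda>x. True) (lens_space p q') (lens_space p q') (f \<circ> g) id"
    using he unfolding homotopy_equivalent_space_def by blast
  obtain F where F: "continuous_on ?S F" "F \<in> ?S \<rightarrow> ?S"
    "\<And>x. x \<in> ?S \<Longrightarrow> lens_orbit p q' (F x) = f (lens_orbit p q x)"
    using lens_space_map_lift[OF q q' f] by blast
  obtain G where G: "continuous_on ?S G" "G \<in> ?S \<rightarrow> ?S"
    "\<And>x. x \<in> ?S \<Longrightarrow> lens_orbit p q (G x) = g (lens_orbit p q' x)"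
    using lens_space_map_lift[OF q(1) q' q(2,3) g] by blast
  have orbit: "lens_orbit p q (lens_action p q k x) = lens_orbit p q x" for q k x
    by (metis lens_orbit_eq_iff)
  have orbit_inv: "lens_invariants p q' x = lens_invariants p q' y"
    if "lens_orbit p q' x = lens_orbit p q' y" for x y
    using that by (simp add: lens_orbit_eq_iff lens_invariants_eq_iff[OF q(1) q'])
  have "\<exists>a :: nat. \<forall>x \<in> ?S. (F \<circ> lens_action p q 1) x = lens_action p q' (int a) (F x)"
  proof (rule lens_invariants_lift_unique[OF q(1) q' F(1,2)])
    show "continuous_on ?S (F \<circ> lens_action p q 1)"
      using F(1) by (intro continuous_on_compose continuous_on_lens_action)
        (auto simp: norm_lens_action elim!: continuous_on_subset)
    show "lens_invariants p q' (F x) = lens_invariants p q' ((F \<circ> lens_action p q 1) x)"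
      if "x \<in> ?S" for x
      using that F(3)[of x] F(3)[of "lens_action p q 1 x"]
      by (intro orbit_inv) (simp add: norm_lens_action orbit)
    show "F \<circ> lens_action p q 1 \<in> ?S \<rightarrow> ?S"
      using F(2) by (auto simp: norm_lens_action simp del: split_paired_All)
  qed
  then obtain a :: nat where a: "\<forall>x \<in> ?S. (F \<circ> lens_action p q 1) x = lens_action p q' (int a) (F x)" ..
  obtain \<psi> where \<psi>:
    "continuous_map (lens_space p q') (top_of_set (lens_invariants p q' ` ?S)) \<psi>"
    "\<And>x. x \<in> ?S \<Longrightarrow> \<psi> (lens_orbit p q' x) = lens_invariants p q' x"
    by (rule lens_space_invariants[OF q(1) q']) (rule that)
  have \<pi>: "continuous_map (top_of_set ?S) (lens_space p q') (lens_orbit p q')"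
    unfolding lens_space_def by (intro quotient_imp_continuous_map quotient_map_quotient_topology)
  have FG: "continuous_on ?S (F \<circ> G)" "F \<circ> G \<in> ?S \<rightarrow> ?S"
    using F(2) G(2) by (auto intro!: continuous_on_compose2[OF F(1) G(1)] simp del: split_paired_All)
  have "homotopic_with_canon (\<lambda>x. True) ?S (lens_invariants p q' ` ?S)
      (\<psi> \<circ> ((f \<circ> g) \<circ> lens_orbit p q')) (\<psi> \<circ> (id \<circ> lens_orbit p q'))"
    by (intro homotopic_with_compose_continuous_map_left[OF _ \<psi>(1)]
        homotopic_with_compose_continuous_map_right[OF fg \<pi>]) (rule TrueI)+
  then obtain h where h: "continuous_on ({0..1::real} \<times> ?S) h" "h \<in> {0..1} \<times> ?S \<rightarrow> lens_invariants p q' ` ?S"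
    "\<And>x. h (0, x) = \<psi> (f (g (lens_orbit p q' x)))" "\<And>x. h (1, x) = \<psi> (lens_orbit p q' x)"
    by (auto simp: homotopic_with_def simp flip: subtopology_Times)
  have h0: "h (0, x) = lens_invariants p q' ((F \<circ> G) x)" if "x \<in> ?S" for x
  proof -
    have "G x \<in> ?S" "F (G x) \<in> ?S"
      using that F(2) G(2) by blast+
    then show ?thesis
      using that h(3)[of x] \<psi>(2)[of "F (G x)"] F(3)[of "G x"] G(3)[of x] by simp
  qed
  \<comment> \<open>The lifted homotopy starts at \<open>F \<circ> G\<close>; at time 1 it is a lift
    of the invariants themselves, hence a deck transformation.\<close>
  obtain k where k: "continuous_on ({0..1} \<times> ?S) k" "k \<in> {0..1} \<times> ?S \<rightarrow> ?S"
    "\<And>y. y \<in> ?S \<Longrightarrow> k (0, y) = (F \<circ> G) y"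
    "\<And>z. z \<in> {0..1} \<times> ?S \<Longrightarrow> h z = lens_invariants p q' (k z)"
    by (rule covering_space_lift_homotopy[OF covering_space_lens_invariants[OF q(1) q'] h(1,2) h0 FG]) (assumption | rule that)+
  have k1: "continuous_on ?S (\<lambda>x. k (1, x))"
    by (rule continuous_on_compose2[OF k(1)]) (auto intro!: continuous_intros)
  have "\<exists>j :: nat. \<forall>x \<in> ?S. k (1, x) = lens_action p q' (int j) x"
  proof (rule lens_invariants_lift_unique[OF q(1) q', of "\<lambda>x. x" "\<lambda>x. k (1, x)"])
    show "lens_invariants p q' x = lens_invariants p q' (k (1, x))" if "x \<in> ?S" for x
      using that k(4)[of "(1, x)"] h(4) \<psi>(2) by simp
    show "(\<lambda>x. k (1, x)) \<in> ?S \<rightarrow> ?S"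
      using k(2) by (auto simp del: split_paired_All)
  qed (simp_all only: continuous_on_id k1 Pi_iff, simp)
  then obtain j :: nat where j: "\<forall>x \<in> ?S. k (1, x) = lens_action p q' (int j) x" ..
  have "continuous_map (prod_topology (top_of_set {0..1}) (top_of_set ?S)) (top_of_set ?S) k"
    using k(1,2) by (simp flip: subtopology_Times)
  then have "homotopic_with_canon (\<lambda>x. True) ?S ?S (F \<circ> G) (lens_action p q' (int j))"
    unfolding homotopic_with[where P = "\<lambda>x. True", OF refl]
    using k(3) j by (intro exI[of _ k]) (simp del: split_paired_All)
  then have "homotopic_with_canon (\<lambda>x. True) ?S ?S (F \<circ> G) id"
    using homotopic_with_trans homotopic_lens_action_id by blast
  then show thesis
    using F(1,2) G(1,2) a by (intro that[of F G a]) (simp_all add: continuous_map_subtopology_eu)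
qed

section \<open>The chain-level invariant of a periodic map\<close>

text \<open>For \<open>m = p\<close> this is the norm element \<open>1 + s + ... + s^(p-1)\<close>
  of the group ring of a cyclic group, acting on chains. Other lengths serve to pass from
  \<open>s\<close> to a power of \<open>s\<close>.\<close>

definition orbit_sum :: "nat \<Rightarrow> ('a \<Rightarrow> 'a) \<Rightarrow> nat \<Rightarrow> 'a chain \<Rightarrow> 'a chain" where
  "orbit_sum n s m c = (\<Sum>i<m. chain_map n (s ^^ i) c)"

lemma sum_lessThan_blocks:
  fixes f :: "nat \<Rightarrow> 'a :: comm_monoid_add"
  shows "(\<Sum>j<m. \<Sum>i<a. f (j * a + i)) = (\<Sum>k<m * a. f k)"
proof -
  have add: "(\<Sum>k<n + a. f k) = (\<Sum>k<n. f k) + (\<Sum>i<a. f (n + i))" for n a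
    by (induction a) (simp_all add: add.assoc)
  show ?thesis
    by (induction m) (simp_all add: add add.commute[of a])
qed

lemma frag_cmul_diff_distrib2: "frag_cmul c (a - b) = frag_cmul c a - frag_cmul c b"
  using frag_cmul_distrib2[of c "a - b" b] by simp

lemma chain_map_comp: "chain_map n (f \<circ> g) c = chain_map n f (chain_map n g c)"
  by (simp add: chain_map_compose)

lemma continuous_map_funpow:
  assumes "continuous_map X X s"
  shows "continuous_map X X (s ^^ i)"
proof (induction i)
  case (Suc i)
  show ?case
    unfolding funpow.simps by (rule continuous_map_compose[OF Suc assms])
qed simp

lemma orbit_sum_diff: "orbit_sum n s m (c - d) = orbit_sum n s m c - orbit_sum n s m d"
  by (simp add: orbit_sum_def chain_map_diff sum_subtractf)

lemma orbit_sum_cmul: "orbit_sum n s m (frag_cmul a c) = frag_cmul a (orbit_sum n s m c)"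
  by (simp add: orbit_sum_def frag_cmul_sum)

lemma singular_chain_orbit_sum:
  assumes "continuous_map X X s" "singular_chain n X c"
  shows "singular_chain n X (orbit_sum n s m c)"
  unfolding orbit_sum_def
  by (intro singular_chain_sum singular_chain_chain_map[OF assms(2)] continuous_map_funpow[OF assms(1)])

lemma chain_boundary_orbit_sum:
  assumes "singular_chain n X c"
  shows "chain_boundary n (orbit_sum n s m c) = orbit_sum (n - Suc 0) s m (chain_boundary n c)"
  by (simp add: orbit_sum_def chain_boundary_sum o_def chain_boundary_chain_map[OF assms])

lemma chain_map_orbit_sum:
  "chain_map n s (orbit_sum n s m c) = orbit_sum n s m (chain_map n s c)"
proof -
  have "chain_map n s (chain_map n (s ^^ i) c) = chain_map n (s ^^ i) (chain_map n s c)" for i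
    by (metis chain_map_comp funpow.simps(2) funpow_Suc_right)
  then show ?thesis
    by (simp add: orbit_sum_def chain_map_sum)
qed

lemma orbit_sum_telescope:
  assumes "singular_chain n X c"
  shows "orbit_sum n s m (chain_map n s c - c) = chain_map n (s ^^ m) c - c"
proof -
  have "chain_map n (s ^^ i) (chain_map n s c) = chain_map n (s ^^ Suc i) c" for i
    by (metis comp_apply chain_map_compose funpow_Suc_right)
  moreover have "chain_map n (s ^^ 0) c = c"
    using chain_map_ident[OF assms] by (simp add: id_def[symmetric])
  ultimately show ?thesis
    unfolding orbit_sum_def chain_map_diff
    by (metis (mono_tags, lifting) sum.cong sum_lessThan_telescope[of "\<lambda>i. chain_map n (s ^^ i) c"])
qed

text \<open>Division with remainder writes every exponent below \<open>m * a\<close> uniquely as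
  \<open>j * a + i\<close> with \<open>i < a\<close>.\<close>

lemma orbit_sum_orbit_sum:
  "orbit_sum n (s ^^ a) m (orbit_sum n s a c) = orbit_sum n s (m * a) c"
proof -
  have "orbit_sum n (s ^^ a) m (orbit_sum n s a c)
      = (\<Sum>j<m. \<Sum>i<a. chain_map n (s ^^ (j * a + i)) c)"
    unfolding orbit_sum_def funpow_mult funpow_add chain_map_comp
    by (simp add: chain_map_sum mult.commute)
  also have "\<dots> = orbit_sum n s (m * a) c"
    unfolding orbit_sum_def by (rule sum_lessThan_blocks)
  finally show ?thesis .
qed

lemma chain_map_funpow_period:
  assumes "singular_chain n X c" "\<And>x. x \<in> topspace X \<Longrightarrow> (s ^^ p) x = x"
  shows "chain_map n (s ^^ (p * a + i)) c = chain_map n (s ^^ i) c"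
proof -
  have "((s ^^ p) ^^ a) x = x" if "x \<in> topspace X" for x
    by (induction a) (simp_all add: assms(2) that)
  then have "(s ^^ (p * a + i)) x = (s ^^ i) x" if "x \<in> topspace X" for x
    using that by (simp add: funpow_mult add.commute[of "p * a"] funpow_add)
  then show ?thesis
    by (rule chain_map_eq[OF assms(1)])
qed

lemma orbit_sum_period:
  assumes "singular_chain n X c" "\<And>x. x \<in> topspace X \<Longrightarrow> (s ^^ p) x = x"
  shows "orbit_sum n s (a * p) c = frag_cmul (int a) (orbit_sum n s p c)"
proof -
  have "orbit_sum n s (a * p) c = (\<Sum>j<a. \<Sum>i<p. chain_map n (s ^^ (p * j + i)) c)"
    unfolding orbit_sum_def sum_lessThan_blocks[symmetric] by (simp add: mult.commute)
  also have "\<dots> = (\<Sum>j<a. orbit_sum n s p c)"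
    unfolding orbit_sum_def using chain_map_funpow_period[OF assms] by simp
  also have "\<dots> = frag_cmul (int a) (orbit_sum n s p c)"
    by (induction a) (simp_all add: frag_cmul_distrib add.commute)
  finally show ?thesis .
qed

lemma chain_map_orbit_sum_natural:
  assumes "singular_chain n X c" "continuous_map X X s"
    "\<And>x. x \<in> topspace X \<Longrightarrow> f (s x) = s' (f x)"
  shows "chain_map n f (orbit_sum n s m c) = orbit_sum n s' m (chain_map n f c)"
proof -
  have "(f \<circ> s ^^ i) x = (s' ^^ i \<circ> f) x" if "x \<in> topspace X" for x i
  proof (induction i)
    case (Suc i)
    have "(s ^^ i) x \<in> topspace X"
      using continuous_map_funpow[OF assms(2), of i] that by (auto simp: continuous_map_def)
    then show ?case using Suc assms(3) by simp
  qed simp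
  then have "chain_map n (f \<circ> s ^^ i) c = chain_map n (s' ^^ i \<circ> f) c" for i
    by (rule chain_map_eq[OF assms(1)])
  then show ?thesis
    unfolding orbit_sum_def chain_map_comp by (simp add: chain_map_sum)
qed

section \<open>Towers of chains and their invariant modulo \<open>p\<close>\<close>

definition acyclic_in :: "nat \<Rightarrow> 'a topology \<Rightarrow> bool" where
  "acyclic_in n X \<longleftrightarrow> (\<forall>c. singular_relcycle n X {} c \<longrightarrow> singular_relboundary n X {} c)"

text \<open>The start of a chain map from the standard periodic resolution over the group ring,
  whose differentials alternate between \<open>s - 1\<close> and the norm. When \<open>s\<close> has
  period \<open>p\<close>, the norm of \<open>c3\<close> is a 3-cycle, the obstruction to continuing
  the tower.\<close>

definition lens_tower ::
  "'a topology \<Rightarrow> ('a \<Rightarrow> 'a) \<Rightarrow> nat \<Rightarrow> 'a chain \<Rightarrow> 'a chain \<Rightarrow> 'a chain \<Rightarrow> 'a chain \<Rightarrow> bool" where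
  "lens_tower X s p c0 c1 c2 c3 \<longleftrightarrow>
     singular_chain 0 X c0 \<and> singular_chain 1 X c1 \<and> singular_chain 2 X c2 \<and> singular_chain 3 X c3 \<and>
     chain_boundary 1 c1 = chain_map 0 s c0 - c0 \<and>
     chain_boundary 2 c2 = orbit_sum 1 s p c1 \<and>
     chain_boundary 3 c3 = chain_map 2 s c2 - c2"

text \<open>The norm of \<open>s^a\<close> times \<open>1 + ... + s^(a-1)\<close> is
  \<open>a\<close> times the norm of \<open>s\<close>. One factor \<open>a\<close> therefore enters
  at \<open>c2\<close>, and a second one when the norm of \<open>s^a\<close> is applied to the new
  \<open>c3\<close>.\<close>

lemma lens_tower_funpow:
  assumes s: "continuous_map X X s" "\<And>x. x \<in> topspace X \<Longrightarrow> (s ^^ p) x = x"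
    and T: "lens_tower X s p c0 c1 c2 c3"
  shows "lens_tower X (s ^^ a) p c0 (orbit_sum 1 s a c1) (frag_cmul (int a) c2)
           (frag_cmul (int a) (orbit_sum 3 s a c3))"
    and "orbit_sum 3 (s ^^ a) p (frag_cmul (int a) (orbit_sum 3 s a c3))
           = frag_cmul (int (a * a)) (orbit_sum 3 s p c3)"
proof -
  have c: "singular_chain 0 X c0" "singular_chain 1 X c1" "singular_chain 2 X c2" "singular_chain 3 X c3"
    and d: "chain_boundary 1 c1 = chain_map 0 s c0 - c0" "chain_boundary 2 c2 = orbit_sum 1 s p c1"
     "chain_boundary 3 c3 = chain_map 2 s c2 - c2"
    using T unfolding lens_tower_def by auto
  have "chain_boundary 1 (orbit_sum 1 s a c1) = chain_map 0 (s ^^ a) c0 - c0"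
    using chain_boundary_orbit_sum[OF c(2)] d(1) orbit_sum_telescope[OF c(1)] by simp
  moreover have "chain_boundary 2 (frag_cmul (int a) c2) = orbit_sum 1 (s ^^ a) p (orbit_sum 1 s a c1)"
    using d(2) orbit_sum_period[OF c(2) s(2), of a] by (simp add: chain_boundary_cmul orbit_sum_orbit_sum mult.commute)
  moreover have "chain_boundary 3 (frag_cmul (int a) (orbit_sum 3 s a c3))
      = chain_map 2 (s ^^ a) (frag_cmul (int a) c2) - frag_cmul (int a) c2"
    using chain_boundary_orbit_sum[OF c(4)] d(3) orbit_sum_telescope[OF c(3)]
    by (simp add: chain_boundary_cmul frag_cmul_diff_distrib2)
  ultimately show "lens_tower X (s ^^ a) p c0 (orbit_sum 1 s a c1) (frag_cmul (int a) c2)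
           (frag_cmul (int a) (orbit_sum 3 s a c3))"
    unfolding lens_tower_def using c s(1)
    by (auto intro: singular_chain_orbit_sum singular_chain_cmul)
  show "orbit_sum 3 (s ^^ a) p (frag_cmul (int a) (orbit_sum 3 s a c3))
           = frag_cmul (int (a * a)) (orbit_sum 3 s p c3)"
    using orbit_sum_period[OF c(4) s(2), of a] by (simp add: orbit_sum_cmul orbit_sum_orbit_sum mult.commute)
qed

text \<open>Chain maps commute with boundaries, and by equivariance they carry the action of
  \<open>s\<close> to that of \<open>s'\<close>.\<close>

lemma lens_tower_natural:
  assumes f: "continuous_map X Y f" "continuous_map X X s"
    and eq: "\<And>x. x \<in> topspace X \<Longrightarrow> f (s x) = s' (f x)"
    and T: "lens_tower X s p c0 c1 c2 c3"
  shows "lens_tower Y s' p (chain_map 0 f c0) (chain_map 1 f c1) (chain_map 2 f c2) (chain_map 3 f c3)"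
    and "orbit_sum 3 s' p (chain_map 3 f c3) = chain_map 3 f (orbit_sum 3 s p c3)"
proof -
  have c: "singular_chain 0 X c0" "singular_chain 1 X c1" "singular_chain 2 X c2" "singular_chain 3 X c3"
    and d: "chain_boundary 1 c1 = chain_map 0 s c0 - c0" "chain_boundary 2 c2 = orbit_sum 1 s p c1"
     "chain_boundary 3 c3 = chain_map 2 s c2 - c2"
    using T unfolding lens_tower_def by auto
  have comm: "chain_map n f (chain_map n s c) = chain_map n s' (chain_map n f c)" if "singular_chain n X c" for n c
    using chain_map_eq[OF that, of "f \<circ> s" "s' \<circ> f"] eq by (simp add: chain_map_comp)
  show "lens_tower Y s' p (chain_map 0 f c0) (chain_map 1 f c1) (chain_map 2 f c2) (chain_map 3 f c3)"
    unfolding lens_tower_def using c f(1)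
    by (auto intro: singular_chain_chain_map simp: chain_boundary_chain_map d[unfolded One_nat_def] chain_map_diff comm
        chain_map_orbit_sum_natural[where s' = s' and s = s and f = f and X = X, OF _ f(2) eq])
  show "orbit_sum 3 s' p (chain_map 3 f c3) = chain_map 3 f (orbit_sum 3 s p c3)"
    using chain_map_orbit_sum_natural[where s' = s' and s = s and f = f, OF c(4) f(2) eq] by simp
qed

text \<open>Every power of \<open>s\<close> is homotopic to the identity and so fixes homology
  classes; the sum merely counts its \<open>m\<close> terms.\<close>

lemma homologous_rel_orbit_sum:
  assumes "\<And>i. homotopic_with (\<lambda>x. True) X X (s ^^ i) id" "singular_relcycle n X {} c"
  shows "homologous_rel n X {} (orbit_sum n s m c) (frag_cmul (int m) c)"
proof -
  have "homologous_rel n X {} (chain_map n (s ^^ i) c) (chain_map n id c)" for i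
    by (rule homotopic_imp_homologous_rel_chain_maps[where T = "{}"])
      (use assms in \<open>auto elim: homotopic_with_mono\<close>)
  moreover have "chain_map n id c = c"
    using assms(2) by (intro chain_map_ident[of n X]) (simp add: singular_cycle)
  ultimately have *: "homologous_rel n X {} (chain_map n (s ^^ i) c) c" for i
    by simp
  show ?thesis
    unfolding orbit_sum_def
  proof (induction m)
    case (Suc m)
    then show ?case
      using homologous_rel_add[OF Suc *[of m]] by (simp add: frag_cmul_distrib add.commute)
  qed simp
qed

text \<open>This compares two chain maps out of the resolution: \<open>b\<close>, \<open>u\<close>
  and \<open>v\<close> are the successive terms of a chain homotopy between the towers. In degree 3
  they leave a cycle, on which the norm acts as multiplication by \<open>p\<close> up to
  boundaries.\<close>

lemma lens_tower_unique:
  assumes s: "continuous_map X X s" "\<And>x. x \<in> topspace X \<Longrightarrow> (s ^^ p) x = x"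
    and hom: "\<And>i. homotopic_with (\<lambda>x. True) X X (s ^^ i) id"
    and acyc: "acyclic_in 1 X" "acyclic_in 2 X"
    and b: "singular_chain 1 X b" "chain_boundary 1 b = c0' - c0"
    and T: "lens_tower X s p c0 c1 c2 c3" and T': "lens_tower X s p c0' c1' c2' c3'"
  obtains e where "singular_relcycle 3 X {} e"
    "homologous_rel 3 X {} (orbit_sum 3 s p c3' - orbit_sum 3 s p c3) (frag_cmul (int p) e)"
proof -
  have c: "singular_chain 0 X c0" "singular_chain 1 X c1" "singular_chain 2 X c2" "singular_chain 3 X c3"
    and d: "chain_boundary 1 c1 = chain_map 0 s c0 - c0" "chain_boundary 2 c2 = orbit_sum 1 s p c1"
     "chain_boundary 3 c3 = chain_map 2 s c2 - c2"
    using T unfolding lens_tower_def by auto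
  have c': "singular_chain 0 X c0'" "singular_chain 1 X c1'" "singular_chain 2 X c2'" "singular_chain 3 X c3'"
    and d': "chain_boundary 1 c1' = chain_map 0 s c0' - c0'" "chain_boundary 2 c2' = orbit_sum 1 s p c1'"
     "chain_boundary 3 c3' = chain_map 2 s c2' - c2'"
    using T' unfolding lens_tower_def by auto
  note chain = singular_chain_diff singular_chain_chain_map[OF _ s(1)] singular_chain_orbit_sum[OF s(1)]
  \<comment> \<open>The norm kills \<open>s - 1\<close>, because \<open>s^p\<close> is the
    identity.\<close>
  have tele: "orbit_sum n s p (chain_map n s z - z) = 0" if "singular_chain n X z" for n z
    using orbit_sum_telescope[OF that] chain_map_funpow_period[OF that s(2), of 1 0] chain_map_ident[OF that]
    by (simp add: id_def)
  note [simp] = One_nat_def[symmetric]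
  note [simp del] = One_nat_def
  have "singular_relcycle 1 X {} (c1' - c1 - (chain_map 1 s b - b))"
    using c c' b by (auto simp: singular_cycle chain_boundary_diff chain_boundary_chain_map[OF b(1)] b(2) d d' chain_map_diff intro!: chain)
  then obtain u where u: "singular_chain 2 X u" "chain_boundary 2 u = c1' - c1 - (chain_map 1 s b - b)"
    using acyc(1) unfolding acyclic_in_def singular_boundary by (metis Suc_1)
  have "chain_boundary 2 (orbit_sum 2 s p u) = orbit_sum 1 s p c1' - orbit_sum 1 s p c1"
    using chain_boundary_orbit_sum[OF u(1)] u(2) tele[OF b(1)] by (simp add: orbit_sum_diff)
  then have "singular_relcycle 2 X {} (c2' - c2 - orbit_sum 2 s p u)"
    using c c' u by (auto simp: singular_cycle chain_boundary_diff d d' intro!: chain)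
  then obtain v where v: "singular_chain 3 X v" "chain_boundary 3 v = c2' - c2 - orbit_sum 2 s p u"
    using acyc(2) unfolding acyclic_in_def singular_boundary by (metis numeral_3_eq_3 Suc_1 One_nat_def)
  \<comment> \<open>In the other order, \<open>s - 1\<close> kills the norm; this makes the next
    chain closed.\<close>
  have "chain_map 2 s (orbit_sum 2 s p u) = orbit_sum 2 s p u"
    using tele[OF u(1)] by (simp add: chain_map_orbit_sum orbit_sum_diff)
  then have cyc: "singular_relcycle 3 X {} (c3' - c3 - (chain_map 3 s v - v))"
    using c c' v by (auto simp: singular_cycle chain_boundary_diff chain_boundary_chain_map[OF v(1)] d d' chain_map_diff intro!: chain)
  have "orbit_sum 3 s p (c3' - c3 - (chain_map 3 s v - v)) = orbit_sum 3 s p c3' - orbit_sum 3 s p c3"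
    using tele[OF v(1)] by (simp add: orbit_sum_diff)
  then show thesis
    using that[OF cyc] homologous_rel_orbit_sum[OF hom cyc, of p] by simp
qed

section \<open>Divisibility of homology classes of spheres\<close>

definition homology_dvd :: "int \<Rightarrow> nat \<Rightarrow> 'a topology \<Rightarrow> 'a chain \<Rightarrow> bool" where
  "homology_dvd m n X z \<longleftrightarrow>
     (\<exists>y. singular_relcycle n X {} y \<and> homologous_rel n X {} z (frag_cmul m y))"

lemma homology_dvd_cong:
  "homologous_rel n X {} z z' \<Longrightarrow> homology_dvd m n X z \<longleftrightarrow> homology_dvd m n X z'"
  unfolding homology_dvd_def using homologous_rel_sym homologous_rel_trans by blast

lemma homology_dvd_minus:
  fixes X :: "'a topology"
  shows "homology_dvd m n X (- z) \<longleftrightarrow> homology_dvd m n X z"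
proof -
  have "homology_dvd m n X (- z)" if dvd: "homology_dvd m n X z" for z :: "'a chain"
  proof -
    obtain y where y: "singular_relcycle n X {} y" "homologous_rel n X {} z (frag_cmul m y)"
      using dvd unfolding homology_dvd_def by blast
    then have "homologous_rel n X {} (- z) (frag_cmul m (- y))"
      using homologous_rel_diff[OF homologous_rel_refl[of n X "{}" 0] y(2)] frag_cmul_distrib2[of m y "- y"]
      by (simp add: add_eq_0_iff)
    then show ?thesis
      unfolding homology_dvd_def using y(1) singular_relcycle_minus by blast
  qed
  from this[of z] this[of "- z"] show ?thesis by auto
qed

lemma singular_relboundary_empty_imp: "singular_relboundary n X {} c \<Longrightarrow> singular_relboundary n X S c"
  unfolding singular_relboundary
  by (metis singular_chain_mono empty_subsetI)

text \<open>
  This makes the boundary isomorphism from the top homology of a sphere to that of its equator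
  explicit: it sends the class of \<open>u + l\<close> to the class of the boundary of \<open>u\<close>.
\<close>
lemma homology_dvd_nsphere_step:
  assumes u: "singular_chain (Suc n) (subtopology (nsphere (Suc k)) {x. x (Suc k) \<ge> 0}) u"
    and l: "singular_chain (Suc n) (subtopology (nsphere (Suc k)) {x. x (Suc k) \<le> 0}) l"
    and du: "singular_chain n (nsphere k) (chain_boundary (Suc n) u)"
    and dvd: "homology_dvd m (Suc n) (nsphere (Suc k)) (u + l)"
  shows "homology_dvd m n (nsphere k) (chain_boundary (Suc n) u)"
proof -
  let ?X = "nsphere (Suc k)" and ?E = "{x::nat\<Rightarrow>real. x (Suc k) = 0}"
    and ?L = "{x::nat\<Rightarrow>real. x (Suc k) \<le> 0}" and ?N = "Suc n"
  let ?U = "subtopology ?X {x. x (Suc k) \<ge> 0}"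
  let ?h = "hom_induced (int ?N) ?U ?E ?X ?L id"
  have UE: "subtopology ?U ?E = nsphere k"
  proof -
    have "{x::nat\<Rightarrow>real. 0 \<le> x (Suc k)} \<inter> ?E = ?E"
      by auto
    then show ?thesis
      by (simp add: subtopology_subtopology subtopology_nsphere_equator)
  qed
  have iso: "?h \<in> iso (relative_homology_group (int ?N) ?U ?E) (relative_homology_group (int ?N) ?X ?L)"
    by (rule iso_relative_homology_group_upper_hemisphere)
  have surj: "?h ` carrier (relative_homology_group (int ?N) ?U ?E) = carrier (relative_homology_group (int ?N) ?X ?L)"
    and inj: "inj_on ?h (carrier (relative_homology_group (int ?N) ?U ?E))"
    using iso by (simp_all only: iso_def bij_betw_def mem_Collect_eq)
  have h: "?h (homologous_rel_set ?N ?U ?E c) = homologous_rel_set ?N ?X ?L c"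
    if "singular_relcycle ?N ?U ?E c" for c
  proof -
    have "chain_map ?N id c = c"
      using that by (intro chain_map_ident[of ?N ?U]) (simp add: singular_relcycle)
    then show ?thesis
      using hom_induced_chain_map_gen[of ?U ?X id ?E ?L ?N c] that
      by (auto simp: continuous_map_from_subtopology)
  qed
  obtain y where y: "singular_relcycle ?N ?X {} y" "homologous_rel ?N ?X {} (u + l) (frag_cmul m y)"
    using dvd unfolding homology_dvd_def by blast
  have "singular_chain ?N ?X y" "chain_boundary ?N y = 0"
    using y(1) by (simp_all add: singular_cycle)
  then have "singular_relcycle ?N ?X ?L y"
    by (simp add: singular_relcycle)
  \<comment> \<open>By surjectivity, \<open>y\<close> agrees modulo the lower hemisphere with a
    relative cycle \<open>v\<close> of the upper hemisphere modulo the equator.\<close>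
  then have "homologous_rel_set ?N ?X ?L y \<in> ?h ` carrier (relative_homology_group (int ?N) ?U ?E)"
    unfolding surj unfolding carrier_relative_homology_group by blast
  then obtain v where v: "singular_relcycle ?N ?U ?E v" "homologous_rel_set ?N ?X ?L y = homologous_rel_set ?N ?X ?L v"
    using h unfolding carrier_relative_homology_group by auto
  then have yv: "homologous_rel ?N ?X ?L y v"
    by (simp add: homologous_rel_set_eq)
  have w: "singular_relcycle ?N ?U ?E (u - frag_cmul m v)"
    using u du by (intro singular_relcycle_diff singular_relcycle_cmul v(1)) (simp add: singular_relcycle UE)
  have r1: "singular_relboundary ?N ?X ?L (u + l - frag_cmul m y)"
    using y(2) unfolding homologous_rel_def by (rule singular_relboundary_empty_imp)
  have r2: "singular_relboundary ?N ?X ?L (frag_cmul m (y - v))"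
    using yv unfolding homologous_rel_def by (rule singular_relboundary_cmul)
  have r3: "singular_relboundary ?N ?X ?L l"
    using l by (rule singular_chain_imp_relboundary)
  \<comment> \<open>Modulo the lower hemisphere \<open>l\<close> vanishes, \<open>u + l\<close>
    equals \<open>m\<close> times \<open>y\<close>, and \<open>y\<close> equals \<open>v\<close>;
    what remains is \<open>u\<close> minus \<open>m\<close> times \<open>v\<close>.\<close>
  have "singular_relboundary ?N ?X ?L (u + l - frag_cmul m y + frag_cmul m (y - v) - l)"
    by (rule singular_relboundary_diff[OF singular_relboundary_add[OF r1 r2] r3])
  moreover have "u + l - frag_cmul m y + frag_cmul m (y - v) - l = u - frag_cmul m v"
    using frag_cmul_distrib2[of m "y - v" v] by simp
  ultimately have "homologous_rel ?N ?X ?L (u - frag_cmul m v) 0"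
    by (simp add: homologous_rel_def)
  \<comment> \<open>Injectivity moves the vanishing from the sphere modulo its lower hemisphere to
    the upper hemisphere modulo the equator.\<close>
  then have "?h (homologous_rel_set ?N ?U ?E (u - frag_cmul m v)) = ?h (homologous_rel_set ?N ?U ?E 0)"
    unfolding h[OF w] h[OF singular_relcycle_0] homologous_rel_set_eq .
  then have "homologous_rel_set ?N ?U ?E (u - frag_cmul m v) = homologous_rel_set ?N ?U ?E 0"
    by (rule inj_onD[OF inj]) (unfold carrier_relative_homology_group, (rule imageI, simp add: w)+)
  then have "singular_relboundary ?N ?U ?E (u - frag_cmul m v)"
    unfolding homologous_rel_set_eq by (simp add: homologous_rel_def)
  \<comment> \<open>Taking boundaries in this decomposition kills the term of \<open>d\<close> and
    leaves the boundary of \<open>e\<close>, a chain in the equator.\<close>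
  then obtain d e where d: "singular_chain (Suc ?N) ?U d" and e: "singular_chain ?N (nsphere k) e"
    and eq: "u - frag_cmul m v = chain_boundary (Suc ?N) d + e"
    unfolding singular_relboundary UE by metis
  have "chain_boundary ?N u - frag_cmul m (chain_boundary ?N v) = chain_boundary ?N e"
    using arg_cong[OF eq, of "chain_boundary ?N"] chain_boundary_boundary_alt[OF d]
    by (simp add: chain_boundary_diff chain_boundary_add chain_boundary_cmul)
  then have "homologous_rel n (nsphere k) {} (chain_boundary ?N u) (frag_cmul m (chain_boundary ?N v))"
    unfolding homologous_rel_def singular_boundary using e by metis
  moreover have "singular_relcycle n (nsphere k) {} (chain_boundary ?N v)"
    using v(1) chain_boundary_boundary_alt[of n ?U v] by (simp add: singular_cycle singular_relcycle UE)
  ultimately show ?thesis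
    unfolding homology_dvd_def by blast
qed

text \<open>A 1-simplex in a two-point space is constant by connectedness, so its two faces coincide
  and cancel.\<close>

lemma singular_boundary_nsphere_0:
  assumes "singular_chain (Suc 0) (nsphere 0) c"
  shows "chain_boundary (Suc 0) c = 0"
  using assms unfolding singular_chain_def
proof (induction c rule: frag_induction)
  case (one f)
  then have f: "continuous_map (subtopology (powertop_real UNIV) (standard_simplex 1)) (nsphere 0) f"
    by (simp add: singular_simplex_def)
  have "connectedin euclideanreal ((\<lambda>x. f x 0) ` standard_simplex 1)"
  proof (rule connectedin_continuous_map_image)
    show "continuous_map (subtopology (powertop_real UNIV) (standard_simplex 1)) euclideanreal (\<lambda>x. f x 0)"
      using continuous_map_compose[OF f continuous_map_nsphere_projection] by (simp add: o_def)
  qed (simp add: connectedin_subtopology connectedin_standard_simplex)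
  then have ivl: "is_interval ((\<lambda>x. f x 0) ` standard_simplex 1)"
    by (simp add: is_interval_connected_1)
  have pm: "f x 0 = 1 \<or> f x 0 = -1" "\<And>i. i > 0 \<Longrightarrow> f x i = 0" if "x \<in> standard_simplex 1" for x
    using continuous_map_funspace[OF f] that
    by (auto simp: nsphere power2_eq_1_iff Pi_iff)
  have const: "f x = f y" if "x \<in> standard_simplex 1" "y \<in> standard_simplex 1" for x y
  proof -
    have "f x 0 = f y 0"
    proof (rule ccontr)
      assume "f x 0 \<noteq> f y 0"
      then have "(0::real) \<in> (\<lambda>x. f x 0) ` standard_simplex 1"
        using pm(1)[OF that(1)] pm(1)[OF that(2)] that
          mem_is_interval_1_I[OF ivl, of "f x 0" "f y 0" 0] mem_is_interval_1_I[OF ivl, of "f y 0" "f x 0" 0]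
        by auto
      then show False
        using pm(1) by force
    qed
    then show ?thesis
      using pm(2)[OF that(1)] pm(2)[OF that(2)] by (metis ext neq0_conv)
  qed
  have "singular_face (Suc 0) 0 f = singular_face (Suc 0) (Suc 0) f"
    unfolding singular_face_def
    by (rule restrict_ext) (simp, intro const, simp_all add: simplical_face_in_standard_simplex)
  then show ?case
    by (simp add: chain_boundary_of)
next
  case (diff a b)
  then show ?case by (simp add: chain_boundary_diff)
qed simp

text \<open>Boundaries vanish in the 0-sphere, so divisibility becomes an equation of chains, whose
  coefficient at \<open>b\<close> would make 1 a multiple of \<open>m\<close>.\<close>

lemma not_homology_dvd_nsphere_0:
  assumes "a \<noteq> b" "1 < m"
  shows "\<not> homology_dvd m 0 (nsphere 0) (frag_of b - frag_of a)"
proof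
  assume "homology_dvd m 0 (nsphere 0) (frag_of b - frag_of a)"
  then obtain y d where "singular_chain (Suc 0) (nsphere 0) d"
    "chain_boundary (Suc 0) d = frag_of b - frag_of a - frag_cmul m y"
    unfolding homology_dvd_def homologous_rel_def singular_boundary by metis
  then have "frag_of b - frag_of a = frag_cmul m y"
    using singular_boundary_nsphere_0 by fastforce
  then have "Poly_Mapping.lookup (frag_of b - frag_of a) b = m * Poly_Mapping.lookup y b"
    by simp
  then have "1 = m * Poly_Mapping.lookup y b"
    using assms(1) by (simp add: lookup_minus)
  then show False
    using assms(2) by (metis abs_mult abs_one abs_zmult_eq_1 abs_of_nonneg less_irrefl less_imp_le order.strict_trans zero_less_one)
qed

section \<open>Chains on the join of two circles\<close>

text \<open>Points of \<open>nsphere 3\<close> are real sequences that vanish from index 4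
  on.\<close>

definition sphere_coords :: "complex \<times> complex \<Rightarrow> nat \<Rightarrow> real" where
  "sphere_coords = (\<lambda>(z, w) i. if i = 0 then Re z else if i = 1 then Im z else if i = 2 then Re w
     else if i = 3 then Im w else 0)"

definition sphere_point :: "(nat \<Rightarrow> real) \<Rightarrow> complex \<times> complex" where
  "sphere_point x = (Complex (x 0) (x 1), Complex (x 2) (x 3))"

lemma sphere_point_coords [simp]: "sphere_point (sphere_coords x) = x"
  by (cases x) (simp add: sphere_point_def sphere_coords_def)

lemma nsphere_eq_top_of_set: "nsphere n = top_of_set (topspace (nsphere n))"
  by (simp add: nsphere euclidean_product_topology)

lemma continuous_on_coordinate: "continuous_on S (\<lambda>x :: nat \<Rightarrow> real. x i)"
  by (rule continuous_on_subset[OF continuous_on_product_coordinates subset_UNIV])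

lemma continuous_on_sphere_coords: "continuous_on S sphere_coords"
proof (rule continuous_on_coordinatewise_then_product)
  show "continuous_on S (\<lambda>x. sphere_coords x i)" for i
    unfolding sphere_coords_def case_prod_unfold
    by (cases "i = 0"; cases "i = 1"; cases "i = 2"; cases "i = 3") (auto intro!: continuous_intros)
qed

lemma continuous_on_sphere_point: "continuous_on S sphere_point"
  unfolding sphere_point_def complex_eq_iff Complex_eq
  by (intro continuous_intros continuous_on_coordinate)

lemma topspace_nsphere_3: "topspace (nsphere 3) = sphere_coords ` sphere 0 1"
proof -
  have eq: "sum f {..3} = f 0 + f 1 + f 2 + f 3" for f :: "nat \<Rightarrow> real"
    by (simp add: eval_nat_numeral)
  show ?thesis
  proof (intro equalityI subsetI)
    fix x assume x: "x \<in> topspace (nsphere 3)"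
    then have "x = sphere_coords (sphere_point x)"
      by (auto simp: nsphere sphere_coords_def sphere_point_def fun_eq_iff)
    moreover have "sphere_point x \<in> sphere 0 1"
      using x by (simp add: nsphere eq sphere_point_def norm_prod_def cmod_power2)
    ultimately show "x \<in> sphere_coords ` sphere 0 1"
      by blast
  next
    fix x assume "x \<in> sphere_coords ` sphere 0 1"
    then show "x \<in> topspace (nsphere 3)"
      by (auto simp: nsphere eq sphere_coords_def norm_prod_def cmod_power2)
  qed
qed

lemma homeomorphic_maps_sphere_coords:
  "homeomorphic_maps (top_of_set (sphere 0 1)) (nsphere 3) sphere_coords sphere_point"
  by (subst nsphere_eq_top_of_set)
    (auto simp: homeomorphic_maps_def topspace_nsphere_3 continuous_on_sphere_coords continuous_on_sphere_point)

text \<open>Where \<open>f\<close> vanishes the angle may behave arbitrarily nearby, but the modulus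
  \<open>sqrt (f x)\<close> forces the limit 0. Elsewhere the formula is a composite of continuous
  functions.\<close>

lemma continuous_on_polar:
  fixes f g :: "'a::topological_space \<Rightarrow> real"
  assumes f: "continuous_on A f" and g: "continuous_on A g" and nn: "\<And>x. x \<in> A \<Longrightarrow> 0 \<le> f x"
  shows "continuous_on A (\<lambda>x. of_real (sqrt (f x)) * cis (g x / f x))"
  unfolding continuous_on_def
proof
  fix x assume x: "x \<in> A"
  have f': "(f \<longlongrightarrow> f x) (at x within A)" and g': "(g \<longlongrightarrow> g x) (at x within A)"
    using f g x by (auto simp: continuous_on_def)
  show "((\<lambda>x. of_real (sqrt (f x)) * cis (g x / f x)) \<longlongrightarrow> of_real (sqrt (f x)) * cis (g x / f x)) (at x within A)"
  proof (cases "f x = 0")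
    case True
    have "((\<lambda>y. sqrt (f y)) \<longlongrightarrow> 0) (at x within A)"
      using tendsto_real_sqrt[OF f'] True by simp
    moreover have "\<forall>\<^sub>F y in at x within A. norm (of_real (sqrt (f y)) * cis (g y / f y)) \<le> sqrt (f y)"
      unfolding eventually_at_filter by (rule always_eventually) (simp add: norm_mult nn)
    ultimately have "((\<lambda>y. of_real (sqrt (f y)) * cis (g y / f y)) \<longlongrightarrow> 0) (at x within A)"
      by (rule Lim_null_comparison[rotated])
    then show ?thesis
      using True by simp
  next
    case False
    then show ?thesis
      unfolding cis_conv_exp by (intro tendsto_intros f' g')
  qed
qed

text \<open>
  The join of two circles: \<open>x\<close> records the barycentric weight and the weighted angle on the
  first circle in \<open>x 0\<close> and \<open>x 1\<close>, and on the second circle in \<open>x 2\<close> and \<open>x 3\<close>. At weight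
  \<open>0\<close> the quotient is a junk value, which the factor \<open>sqrt 0\<close> makes harmless.
\<close>
definition join_map :: "(nat \<Rightarrow> real) \<Rightarrow> nat \<Rightarrow> real" where
  "join_map x = sphere_coords
     (of_real (sqrt (x 0)) * cis (x 1 / x 0), of_real (sqrt (x 2)) * cis (x 3 / x 2))"

text \<open>The angle is a real number rather than a class modulo \<open>2 * pi\<close>, so that
  affine combinations of vertices make sense; \<open>join_map\<close> wraps it around the
  circle.\<close>

definition fst_vertex :: "real \<Rightarrow> nat \<Rightarrow> real" where
  "fst_vertex a = (\<lambda>i. if i = 0 then 1 else if i = 1 then a else 0)"

definition snd_vertex :: "real \<Rightarrow> nat \<Rightarrow> real" where
  "snd_vertex b = (\<lambda>i. if i = 2 then 1 else if i = 3 then b else 0)"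

text \<open>The angle conditions apply only at positive weight, where the angle is defined. An empty
  \<open>B\<close> thus forces the second weight to be 0 and describes a part of the first
  circle.\<close>

definition join_cell :: "real set \<Rightarrow> real set \<Rightarrow> (nat \<Rightarrow> real) set" where
  "join_cell A B = {x. 0 \<le> x 0 \<and> 0 \<le> x 2 \<and> x 0 + x 2 = 1 \<and>
     (0 < x 0 \<longrightarrow> x 1 / x 0 \<in> A) \<and> (0 < x 2 \<longrightarrow> x 3 / x 2 \<in> B)}"

section \<open>Join coordinates, rotations and affine simplices\<close>

lemma join_map_coords [simp]:
  "join_map x 0 = sqrt (x 0) * cos (x 1 / x 0)" "join_map x (Suc 0) = sqrt (x 0) * sin (x 1 / x 0)"
  "join_map x 2 = sqrt (x 2) * cos (x 3 / x 2)" "join_map x 3 = sqrt (x 2) * sin (x 3 / x 2)"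
  by (simp_all add: join_map_def sphere_coords_def)

lemma continuous_map_join_map:
  "continuous_map (subtopology (powertop_real UNIV) (join_cell A B)) (nsphere 3) join_map"
proof -
  have "continuous_on (join_cell A B) join_map"
    unfolding join_map_def
    by (intro continuous_on_compose2[OF continuous_on_sphere_coords] continuous_on_Pair
        continuous_on_polar continuous_on_coordinate) (auto simp: join_cell_def)
  moreover have "join_map \<in> join_cell A B \<rightarrow> topspace (nsphere 3)"
    unfolding topspace_nsphere_3
    by (auto simp: join_map_def join_cell_def norm_prod_def norm_mult)
  ultimately show ?thesis
    by (subst nsphere_eq_top_of_set) (simp add: euclidean_product_topology)
qed

text \<open>A rotation in join coordinates: the increment carries the weight as a factor, so the map
  is linear, and at positive weight the angle itself grows by \<open>a\<close> or
  \<open>b\<close>.\<close>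

definition shift :: "real \<Rightarrow> real \<Rightarrow> (nat \<Rightarrow> real) \<Rightarrow> nat \<Rightarrow> real" where
  "shift a b x = x(1 := x 1 + a * x 0, 3 := x 3 + b * x 2)"

definition rotation :: "real \<Rightarrow> real \<Rightarrow> (nat \<Rightarrow> real) \<Rightarrow> nat \<Rightarrow> real" where
  "rotation a b x = sphere_coords (cis a * fst (sphere_point x), cis b * snd (sphere_point x))"

lemma join_map_shift: "join_map (shift a b x) = rotation a b (join_map x)"
proof -
  have *: "of_real (sqrt r) * cis ((t + a * r) / r) = cis a * (of_real (sqrt r) * cis (t / r))" for a r t
    by (cases "r = 0") (simp_all add: add_divide_distrib cis_mult[symmetric] mult_ac)
  show ?thesis
    by (simp add: join_map_def shift_def rotation_def *)
qed

lemma shift_vertex [simp]: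
  "shift a b (fst_vertex t) = fst_vertex (t + a)" "shift a b (snd_vertex t) = snd_vertex (t + b)"
  by (auto simp: shift_def fst_vertex_def snd_vertex_def fun_eq_iff)

definition join_simplex :: "(nat \<Rightarrow> real) list \<Rightarrow> (nat \<Rightarrow> real) chain" where
  "join_simplex vs = chain_map (length vs - 1) join_map
     (frag_of (oriented_simplex (length vs - 1) (\<lambda>j. vs ! j)))"

text \<open>\<open>shift\<close> is linear, so it commutes with the affine parametrisation of a
  simplex by its vertices.\<close>

lemma chain_map_rotation_join_simplex:
  assumes "vs \<noteq> []"
  shows "chain_map (length vs - 1) (rotation a b) (join_simplex vs) = join_simplex (map (shift a b) vs)"
proof -
  let ?n = "length vs - 1"
  have "rotation a b (join_map (oriented_simplex ?n ((!) vs) x))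
      = join_map (oriented_simplex ?n ((!) (map (shift a b) vs)) x)" if "x \<in> standard_simplex ?n" for x
  proof -
    have "oriented_simplex ?n ((!) (map (shift a b) vs)) x = shift a b (oriented_simplex ?n ((!) vs) x)"
    proof
      fix i
      have "(\<Sum>j\<le>?n. (map (shift a b) vs ! j) i * x j) = (\<Sum>j\<le>?n. shift a b (vs ! j) i * x j)"
        by (intro sum.cong refl arg_cong2[where f = "(*)"] fun_cong[OF nth_map])
          (use assms in \<open>cases vs; simp\<close>)
      also have "\<dots> = shift a b (\<lambda>i. \<Sum>j\<le>?n. (vs ! j) i * x j) i"
        by (simp add: shift_def distrib_right distrib_left sum.distrib sum_distrib_left mult_ac)
      finally show "oriented_simplex ?n ((!) (map (shift a b) vs)) x i = shift a b (oriented_simplex ?n ((!) vs) x) i"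
        using that by (simp add: oriented_simplex_def)
    qed
    then show ?thesis
      by (simp add: join_map_shift)
  qed
  then have "simplex_map ?n (rotation a b) (simplex_map ?n join_map (oriented_simplex ?n ((!) vs)))
      = simplex_map ?n join_map (oriented_simplex ?n ((!) (map (shift a b) vs)))"
    unfolding simplex_map_def by (intro restrict_ext) simp
  then show ?thesis
    by (simp add: join_simplex_def)
qed

text \<open>At a point of the simplex, the quotient of weighted angle by weight is a convex
  combination of the vertex angles on that circle, so it stays in the convex set \<open>A\<close> or
  \<open>B\<close>.\<close>

lemma singular_chain_join_simplex:
  assumes "vs \<noteq> []" "set vs \<subseteq> fst_vertex ` A \<union> snd_vertex ` B" "convex A" "convex B"
    and D: "join_map ` join_cell A B \<subseteq> D"
  shows "singular_chain (length vs - 1) (subtopology (nsphere 3) D) (join_simplex vs)"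
proof -
  let ?n = "length vs - 1"
  have v: "vs ! j \<in> fst_vertex ` A \<union> snd_vertex ` B" if "j \<le> ?n" for j
  proof -
    have "j < length vs"
      using that assms(1) by (cases vs) auto
    then show ?thesis
      using assms(2) nth_mem by blast
  qed
  have "(\<lambda>i. \<Sum>j\<le>?n. (vs ! j) i * x j) \<in> join_cell A B" if x: "x \<in> standard_simplex ?n" for x
  proof -
    define y where "y = (\<lambda>i. \<Sum>j\<le>?n. (vs ! j) i * x j)"
    have x0: "\<And>j. 0 \<le> x j" and x1: "sum x {..?n} = 1"
      using x by (auto simp: standard_simplex_def)
    \<comment> \<open>The vertices on the first and on the second circle; coordinate 0 tells them
      apart.\<close>
    define J K where "J = {j. j \<le> ?n \<and> vs ! j \<in> fst_vertex ` A}" and "K = {j. j \<le> ?n \<and> vs ! j \<in> snd_vertex ` B}"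
    have J: "(vs ! j) 0 = 1" "(vs ! j) 1 \<in> A" "(vs ! j) 2 = 0" "(vs ! j) 3 = 0" if "j \<in> J" for j
      using that by (auto simp: J_def fst_vertex_def)
    have K: "(vs ! j) 0 = 0" "(vs ! j) 1 = 0" "(vs ! j) 2 = 1" "(vs ! j) 3 \<in> B" if "j \<in> K" for j
      using that by (auto simp: K_def snd_vertex_def)
    have "{..?n} = J \<union> K"
      using v unfolding J_def K_def by blast
    moreover have "J \<inter> K = {}"
      using J(1) K(1) by fastforce
    moreover have "finite J" "finite K"
      by (simp_all add: J_def K_def)
    ultimately have JK: "{..?n} = J \<union> K" "J \<inter> K = {}" "finite J" "finite K" .
    have y: "y i = (\<Sum>j\<in>J. (vs ! j) i * x j) + (\<Sum>j\<in>K. (vs ! j) i * x j)" for i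
      unfolding y_def JK(1) by (rule sum.union_disjoint) (use JK in auto)
    have y0: "y 0 = sum x J" and y2: "y 2 = sum x K"
      and y1: "y 1 = (\<Sum>j\<in>J. (vs ! j) 1 * x j)" and y3: "y 3 = (\<Sum>j\<in>K. (vs ! j) 3 * x j)"
      unfolding y by (simp_all add: J K K(2)[unfolded One_nat_def])
    have "y 0 + y 2 = 1"
      using x1 JK by (simp add: y0 y2 sum.union_disjoint)
    moreover have "y 1 / y 0 \<in> A" if "0 < y 0"
    proof -
      have "(\<Sum>j\<in>J. (x j / y 0) *\<^sub>R (vs ! j) 1) \<in> A"
        by (rule convex_sum) (use that x0 J assms(3) JK in \<open>auto simp: y0 simp flip: sum_divide_distrib\<close>)
      then show ?thesis
        unfolding y1 sum_divide_distrib by (simp add: mult.commute)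
    qed
    moreover have "y 3 / y 2 \<in> B" if "0 < y 2"
    proof -
      have "(\<Sum>j\<in>K. (x j / y 2) *\<^sub>R (vs ! j) 3) \<in> B"
        by (rule convex_sum) (use that x0 K assms(4) JK in \<open>auto simp: y2 simp flip: sum_divide_distrib\<close>)
      then show ?thesis
        unfolding y3 sum_divide_distrib by (simp add: mult.commute)
    qed
    ultimately show ?thesis
      unfolding y_def[symmetric] by (simp add: join_cell_def y0 y2 sum_nonneg x0)
  qed
  then have "simplicial_simplex ?n (join_cell A B) (oriented_simplex ?n ((!) vs))"
    unfolding simplicial_simplex_oriented_simplex by blast
  then have "singular_chain ?n (subtopology (powertop_real UNIV) (join_cell A B)) (frag_of (oriented_simplex ?n ((!) vs)))"
    by (simp add: singular_chain_of simplicial_imp_singular_simplex)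
  moreover have "continuous_map (subtopology (powertop_real UNIV) (join_cell A B)) (subtopology (nsphere 3) D) join_map"
    using D by (auto simp: continuous_map_in_subtopology continuous_map_join_map)
  ultimately show ?thesis
    unfolding join_simplex_def by (rule singular_chain_chain_map)
qed

lemma chain_boundary_join_simplex:
  "chain_boundary 1 (join_simplex [a, b]) = join_simplex [b] - join_simplex [a]"
  "chain_boundary 2 (join_simplex [a, b, c]) = join_simplex [b, c] - join_simplex [a, c] + join_simplex [a, b]"
  "chain_boundary 3 (join_simplex [a, b, c, d]) = join_simplex [b, c, d] - join_simplex [a, c, d]
     + join_simplex [a, b, d] - join_simplex [a, b, c]"
  "chain_boundary 4 (join_simplex [a, b, c, d, e]) = join_simplex [b, c, d, e] - join_simplex [a, c, d, e]
     + join_simplex [a, b, d, e] - join_simplex [a, b, c, e] + join_simplex [a, b, c, d]"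
proof -
  have chain: "singular_chain n (powertop_real UNIV) (frag_of (oriented_simplex n l))" for n l
    using simplicial_imp_singular_simplex[of n UNIV "oriented_simplex n l"]
    by (auto simp: singular_chain_of simplicial_simplex)
  \<comment> \<open>The \<open>k\<close>-th face of an affine simplex omits its \<open>k\<close>-th
    vertex.\<close>
  have face: "singular_face n k (oriented_simplex n ((!) vs)) = oriented_simplex (n - 1) ((!) ws)"
    if "1 \<le> n" "k \<le> n" "length vs = Suc n" "ws = take k vs @ drop (Suc k) vs" for n k and vs ws :: "(nat \<Rightarrow> real) list"
    unfolding singular_face_oriented_simplex[OF that(1,2)] oriented_simplex_eq
    using that by (auto simp: nth_append min_def)
  have bd: "chain_boundary n (join_simplex vs)
      = (\<Sum>k\<le>n. frag_cmul ((-1) ^ k) (join_simplex (take k vs @ drop (Suc k) vs)))"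
    if "1 \<le> n" "length vs = Suc n" for n and vs :: "(nat \<Rightarrow> real) list"
  proof -
    have "chain_boundary n (join_simplex vs)
        = chain_map (n - 1) join_map (chain_boundary n (frag_of (oriented_simplex n ((!) vs))))"
      using that by (simp add: join_simplex_def chain_boundary_chain_map[OF chain] del: chain_map_of)
    also have "\<dots> = (\<Sum>k\<le>n. frag_cmul ((-1) ^ k)
        (chain_map (n - 1) join_map (frag_of (singular_face n k (oriented_simplex n ((!) vs))))))"
      using that by (simp add: chain_boundary_of chain_map_sum del: chain_map_of)
    also have "\<dots> = (\<Sum>k\<le>n. frag_cmul ((-1) ^ k) (join_simplex (take k vs @ drop (Suc k) vs)))"
      using that by (intro sum.cong refl) (simp add: join_simplex_def face[OF _ _ _ refl] min_def)
    finally show ?thesis .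
  qed
  show "chain_boundary 1 (join_simplex [a, b]) = join_simplex [b] - join_simplex [a]"
    by (subst bd) simp_all
  show "chain_boundary 2 (join_simplex [a, b, c]) = join_simplex [b, c] - join_simplex [a, c] + join_simplex [a, b]"
    by (subst bd) (simp_all add: eval_nat_numeral)
  show "chain_boundary 3 (join_simplex [a, b, c, d]) = join_simplex [b, c, d] - join_simplex [a, c, d]
     + join_simplex [a, b, d] - join_simplex [a, b, c]"
    by (subst bd) (simp_all add: eval_nat_numeral)
  show "chain_boundary 4 (join_simplex [a, b, c, d, e]) = join_simplex [b, c, d, e] - join_simplex [a, c, d, e]
     + join_simplex [a, b, d, e] - join_simplex [a, b, c, e] + join_simplex [a, b, c, d]"
    by (subst bd) (simp_all add: eval_nat_numeral)
qed

text \<open>Rotation by full turns is \<open>rotation 0 0\<close> as a function; the two chains are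
  therefore equal, not just homologous.\<close>

lemma join_simplex_periodic:
  assumes "cis a = 1" "cis b = 1" "vs \<noteq> []"
  shows "join_simplex (map (shift a b) vs) = join_simplex vs"
proof -
  have "rotation a b = rotation 0 0"
    using assms by (simp add: rotation_def fun_eq_iff)
  moreover have "map (shift 0 0) vs = vs"
    by (rule map_idI) (simp add: shift_def)
  ultimately show ?thesis
    using chain_map_rotation_join_simplex[OF assms(3)] by metis
qed

lemma chain_map_rotation_funpow_join_simplex:
  assumes "vs \<noteq> []" "n = length vs - 1"
  shows "chain_map n (rotation a b ^^ k) (join_simplex vs) = join_simplex (map (shift (k * a) (k * b)) vs)"
proof (induction k)
  case 0
  have "map (shift 0 0) vs = vs"
    by (rule map_idI) (simp add: shift_def)
  moreover have "chain_map n id (join_simplex vs) = join_simplex vs"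
    by (simp add: join_simplex_def simplex_map_def assms(2))
  ultimately show ?case
    by (simp add: id_def)
next
  case (Suc k)
  have "chain_map n (rotation a b ^^ Suc k) (join_simplex vs)
      = chain_map n (rotation a b) (chain_map n (rotation a b ^^ k) (join_simplex vs))"
    unfolding funpow.simps by (rule chain_map_comp)
  also have "\<dots> = join_simplex (map (shift a b) (map (shift (k * a) (k * b)) vs))"
    using chain_map_rotation_join_simplex[of "map (shift (k * a) (k * b)) vs"] assms Suc by simp
  also have "map (shift a b) (map (shift (k * a) (k * b)) vs) = map (shift (Suc k * a) (Suc k * b)) vs"
    by (simp add: shift_def fun_eq_iff algebra_simps)
  finally show ?case .
qed

section \<open>The subdivided join of circles and the tower of the standard action\<close>

lemma sum_lessThan_cyclic:
  fixes f :: "nat \<Rightarrow> 'a :: ab_group_add"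
  assumes "\<And>i. f (i + p) = f i"
  shows "(\<Sum>i<p. f (i + k)) = (\<Sum>i<p. f i)"
proof (induction k)
  case (Suc k)
  have "(\<Sum>i<Suc p. f (i + k)) = f k + (\<Sum>i<p. f (Suc i + k))"
    by (subst sum.lessThan_Suc_shift) simp
  then show ?case
    using Suc assms[of k] by (simp add: add.commute)
qed simp

text \<open>The join of the first circle, cut into \<open>p\<close> arcs, with the simplex on the
  angles \<open>bs\<close> of the second: for no angle the circle itself, for one angle a disc
  bounded by it, for two angles the region between two such discs.\<close>

definition ring_join :: "nat \<Rightarrow> real list \<Rightarrow> (nat \<Rightarrow> real) chain" where
  "ring_join p bs = (\<Sum>i<p. join_simplex
     (fst_vertex (2 * pi * real i / real p) # fst_vertex (2 * pi * real (Suc i) / real p) # map snd_vertex bs))"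

lemma join_simplex_fst_periodic:
  assumes "cis a = 1"
  shows "join_simplex (fst_vertex (t + a) # map snd_vertex bs) = join_simplex (fst_vertex t # map snd_vertex bs)"
    and "join_simplex (fst_vertex (t + a) # fst_vertex (u + a) # map snd_vertex bs)
       = join_simplex (fst_vertex t # fst_vertex u # map snd_vertex bs)"
  using join_simplex_periodic[OF assms, of 0 "fst_vertex t # map snd_vertex bs"]
    join_simplex_periodic[OF assms, of 0 "fst_vertex t # fst_vertex u # map snd_vertex bs"]
  by (simp_all add: o_def)

lemma join_simplex_ring_telescope:
  assumes "0 < p"
  shows "(\<Sum>i<p. join_simplex (fst_vertex (2 * pi * real (Suc i) / real p) # map snd_vertex bs)
     - join_simplex (fst_vertex (2 * pi * real i / real p) # map snd_vertex bs)) = 0"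
  using sum_lessThan_telescope[of "\<lambda>i. join_simplex (fst_vertex (2 * pi * real i / real p) # map snd_vertex bs)" p]
    join_simplex_fst_periodic(1)[of "2 * pi" 0 bs] assms by simp

text \<open>Faces that omit an endpoint of an arc cancel around the closed circle, so only the faces
  that omit an angle of the second circle survive.\<close>

lemma chain_boundary_ring_join:
  assumes "0 < p"
  shows "chain_boundary 1 (ring_join p []) = 0"
    and "chain_boundary 2 (ring_join p [b]) = ring_join p []"
    and "chain_boundary 3 (ring_join p [b, c]) = ring_join p [c] - ring_join p [b]"
    and "chain_boundary 4 (ring_join p [b, c, d]) = ring_join p [c, d] - ring_join p [b, d] + ring_join p [b, c]"
  using join_simplex_ring_telescope[OF assms, of "[]"] join_simplex_ring_telescope[OF assms, of "[b]"]
    join_simplex_ring_telescope[OF assms, of "[b, c]"] join_simplex_ring_telescope[OF assms, of "[b, c, d]"]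
  unfolding ring_join_def chain_boundary_sum o_def
  by (simp_all add: chain_boundary_join_simplex[unfolded One_nat_def] chain_boundary_join_simplex
      sum.distrib sum_subtractf)

text \<open>Rotation by \<open>2 * pi / p\<close> permutes the arcs of the first circle cyclically,
  so only the angles on the second circle change.\<close>

lemma chain_map_rotation_ring_join:
  assumes "0 < p" "n = Suc (length bs)"
  shows "chain_map n (rotation (2 * pi / p) b ^^ k) (ring_join p bs) = ring_join p (map (\<lambda>t. t + k * b) bs)"
proof -
  let ?f = "\<lambda>i. join_simplex (fst_vertex (2 * pi * real i / p) # fst_vertex (2 * pi * real (Suc i) / p)
      # map snd_vertex (map (\<lambda>t. t + k * b) bs))"
  have per: "?f (i + p) = ?f i" for i
    using join_simplex_fst_periodic(2)[OF cis_2pi, of "2 * pi * real i / p" "2 * pi * real (Suc i) / p"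
        "map (\<lambda>t. t + k * b) bs"] assms
    by (simp add: field_simps)
  have "chain_map n (rotation (2 * pi / p) b ^^ k) (ring_join p bs) = (\<Sum>i<p. ?f (i + k))"
    unfolding ring_join_def
    by (simp add: chain_map_sum chain_map_rotation_funpow_join_simplex assms(2) o_def add_divide_distrib distrib_left mult_ac add_ac)
  also have "\<dots> = (\<Sum>i<p. ?f i)"
    by (rule sum_lessThan_cyclic) (rule per)
  finally show ?thesis
    by (simp add: ring_join_def)
qed

lemma singular_chain_ring_join:
  assumes "set bs \<subseteq> B" "convex B" "join_map ` join_cell UNIV B \<subseteq> D" "n = Suc (length bs)"
  shows "singular_chain n (subtopology (nsphere 3) D) (ring_join p bs)"
  unfolding ring_join_def
proof (rule singular_chain_sum)
  fix i
  let ?vs = "fst_vertex (2 * pi * real i / p) # fst_vertex (2 * pi * real (Suc i) / p) # map snd_vertex bs"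
  have "singular_chain (length ?vs - 1) (subtopology (nsphere 3) D) (join_simplex ?vs)"
    by (rule singular_chain_join_simplex[OF _ _ convex_UNIV assms(2,3)]) (use assms in auto)
  then show "singular_chain n (subtopology (nsphere 3) D) (join_simplex ?vs)"
    using assms by simp
qed

lemma singular_chain_ring_join_nsphere:
  "n = Suc (length bs) \<Longrightarrow> singular_chain n (nsphere 3) (ring_join p bs)"
  using singular_chain_ring_join[of bs UNIV UNIV n p] by simp

text \<open>The whole sphere as the join of two circles cut into \<open>p\<close> arcs each, hence
  \<open>p * p\<close> tetrahedra. As \<open>q\<close> does not occur, it represents the class
  \<open>e\<close> common to all the actions.\<close>

definition torus_join :: "nat \<Rightarrow> (nat \<Rightarrow> real) chain" where
  "torus_join p = (\<Sum>j<p. ring_join p [2 * pi * real j / p, 2 * pi * real (Suc j) / p])"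

text \<open>The tower consists of a point and an arc on the first circle, a disc filling that
  circle, and the \<open>q\<close> sectors between this disc and its image. Together the
  \<open>p\<close> images of these sectors go \<open>q\<close> times around the second
  circle.\<close>

lemma lens_tower_rotation:
  fixes p q :: nat
  assumes p: "0 < p"
  defines "c3 \<equiv> \<Sum>j<q. ring_join p [2 * pi * real j / p, 2 * pi * real (Suc j) / p]"
  shows "lens_tower (nsphere 3) (rotation (2 * pi / p) (2 * pi * q / p)) p (join_simplex [fst_vertex 0])
       (join_simplex [fst_vertex 0, fst_vertex (2 * pi / p)]) (ring_join p [0]) c3"
    and "orbit_sum 3 (rotation (2 * pi / p) (2 * pi * q / p)) p c3 = frag_cmul (int q) (torus_join p)"
proof -
  let ?T = "rotation (2 * pi / p) (2 * pi * q / p)"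
  define W where "W = (\<lambda>j. ring_join p [2 * pi * real j / p, 2 * pi * real (Suc j) / p])"
  have c3: "c3 = sum W {..<q}"
    by (simp add: c3_def W_def)
  have chain: "singular_chain (length vs - 1) (nsphere 3) (join_simplex vs)"
    if "vs \<noteq> []" "set vs \<subseteq> range fst_vertex \<union> range snd_vertex" for vs
    using singular_chain_join_simplex[OF that convex_UNIV convex_UNIV, of UNIV] by simp
  have "singular_chain 0 (nsphere 3) (join_simplex [fst_vertex 0])"
    "singular_chain 1 (nsphere 3) (join_simplex [fst_vertex 0, fst_vertex (2 * pi / p)])"
    using chain[of "[fst_vertex 0]"] chain[of "[fst_vertex 0, fst_vertex (2 * pi / p)]"] by auto
  moreover have "singular_chain 2 (nsphere 3) (ring_join p [0])" "singular_chain 3 (nsphere 3) c3"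
    unfolding c3_def by (intro singular_chain_sum singular_chain_ring_join_nsphere; simp)+
  moreover have "chain_boundary 1 (join_simplex [fst_vertex 0, fst_vertex (2 * pi / p)])
      = chain_map 0 ?T (join_simplex [fst_vertex 0]) - join_simplex [fst_vertex 0]"
    using chain_map_rotation_join_simplex[of "[fst_vertex 0]"]
    by (simp add: chain_boundary_join_simplex(1)[unfolded One_nat_def])
  \<comment> \<open>The \<open>p\<close> translates of the arc make up the circle that bounds the
    disc.\<close>
  moreover have "chain_boundary 2 (ring_join p [0])
      = orbit_sum 1 ?T p (join_simplex [fst_vertex 0, fst_vertex (2 * pi / p)])"
    unfolding chain_boundary_ring_join(2)[OF p]
    unfolding ring_join_def orbit_sum_def
    by (intro sum.cong refl, subst chain_map_rotation_funpow_join_simplex)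
      (simp_all add: distrib_left add_divide_distrib mult_ac add_ac)
  moreover have "chain_boundary 3 c3 = chain_map 2 ?T (ring_join p [0]) - ring_join p [0]"
  proof -
    have "chain_boundary 3 c3 = (\<Sum>j<q. ring_join p [2 * pi * real (Suc j) / p] - ring_join p [2 * pi * real j / p])"
      unfolding c3_def chain_boundary_sum o_def chain_boundary_ring_join(3)[OF p] ..
    also have "\<dots> = ring_join p [2 * pi * q / p] - ring_join p [0]"
      using sum_lessThan_telescope[of "\<lambda>j. ring_join p [2 * pi * real j / p]" q] by simp
    finally show ?thesis
      using chain_map_rotation_ring_join[OF p, of 2 "[0]" 1 "2 * pi * q / p"] by simp
  qed
  ultimately show "lens_tower (nsphere 3) ?T p (join_simplex [fst_vertex 0])
       (join_simplex [fst_vertex 0, fst_vertex (2 * pi / p)]) (ring_join p [0]) c3"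
    unfolding lens_tower_def by blast
  have T: "chain_map 3 (?T ^^ k) (W j) = W (k * q + j)" for k j
    unfolding W_def by (subst chain_map_rotation_ring_join[OF p])
      (simp_all add: distrib_left add_divide_distrib mult_ac add_ac)
  \<comment> \<open>Advancing by \<open>p\<close> sectors is a full turn of the second
    circle.\<close>
  have per: "W (j * p + i) = W i" for i j
  proof -
    let ?i = "2 * pi * real i / p" and ?i' = "2 * pi * real (Suc i) / p" and ?t = "2 * pi * real j"
    have "join_simplex (fst_vertex t # fst_vertex u # map snd_vertex [?i + ?t, ?i' + ?t])
        = join_simplex (fst_vertex t # fst_vertex u # map snd_vertex [?i, ?i'])" for t u
      using join_simplex_periodic[of 0 ?t "fst_vertex t # fst_vertex u # map snd_vertex [?i, ?i']"] by simp
    moreover have "2 * pi * real (j * p + i) / p = ?i + ?t" "2 * pi * real (Suc (j * p + i)) / p = ?i' + ?t"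
      using p by (simp_all add: field_simps)
    ultimately show ?thesis
      unfolding W_def ring_join_def by simp
  qed
  \<comment> \<open>The \<open>p\<close> blocks of \<open>q\<close> consecutive sectors are
    regrouped into \<open>q\<close> blocks of \<open>p\<close>, each a full turn.\<close>
  have "orbit_sum 3 ?T p c3 = (\<Sum>k<p. \<Sum>j<q. W (k * q + j))"
    unfolding c3 orbit_sum_def by (simp add: chain_map_sum T)
  also have "\<dots> = (\<Sum>k<q. \<Sum>j<p. W (k * p + j))"
    unfolding sum_lessThan_blocks by (simp add: mult.commute)
  also have "\<dots> = (\<Sum>k<q. torus_join p)"
    unfolding per by (simp add: W_def torus_join_def)
  also have "\<dots> = frag_cmul (int q) (torus_join p)"
    by (induction q) (simp_all add: frag_cmul_distrib add.commute)
  finally show "orbit_sum 3 ?T p c3 = frag_cmul (int q) (torus_join p)" .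
qed

text \<open>The hypothesis is a triangle relation modulo boundaries, so consecutive pieces merge one
  at a time. For \<open>k = 0\<close> the triple with equal entries shows that \<open>W a a\<close>
  is a boundary.\<close>

lemma homologous_rel_concat:
  assumes "\<And>a b c. singular_relboundary n X {} (W b c - W a c + W a b)"
  shows "homologous_rel n X {} (\<Sum>i<k. W (g i) (g (Suc i))) (W (g 0) (g k))"
proof (induction k)
  case 0
  then show ?case
    using assms[of "g 0" "g 0" "g 0"] singular_relboundary_minus[of n X "{}" "W (g 0) (g 0)"]
    by (simp add: homologous_rel_def)
next
  case (Suc k)
  have eq: "(\<Sum>i<Suc k. W (g i) (g (Suc i))) - W (g 0) (g (Suc k))
      = ((\<Sum>i<k. W (g i) (g (Suc i))) - W (g 0) (g k))
        + (W (g k) (g (Suc k)) - W (g 0) (g (Suc k)) + W (g 0) (g k))"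
    by simp
  show ?case
    unfolding homologous_rel_def eq
    by (rule singular_relboundary_add[OF Suc[unfolded homologous_rel_def] assms])
qed

section \<open>Hemisphere cuts and indivisibility of the fundamental cycle\<close>

lemma nsphere_2: "nsphere 2 = subtopology (nsphere 3) {x. x 3 = 0}"
  using subtopology_nsphere_equator[of 2] by (simp add: eval_nat_numeral)

lemma nsphere_1: "nsphere 1 = subtopology (nsphere 3) ({x. x 3 = 0} \<inter> {x. x 2 = 0})"
  using subtopology_nsphere_equator[of 1] nsphere_2 by (simp add: eval_nat_numeral subtopology_subtopology)

lemma nsphere_0: "nsphere 0 = subtopology (nsphere 3) ({x. x 3 = 0} \<inter> {x. x 2 = 0} \<inter> {x. x 1 = 0})"
  using subtopology_nsphere_equator[of 0] nsphere_1 by (simp add: eval_nat_numeral subtopology_subtopology)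

lemma sin_le_0:
  assumes "pi \<le> x" "x \<le> 2 * pi"
  shows "sin x \<le> 0"
  using sin_ge_zero[of "x - pi"] assms by (simp add: sin_diff)

text \<open>Cutting the angles at 0 and \<open>pi\<close> fixes the signs of sine and cosine, which
  places each piece in the hemisphere or equator where the dimension step needs it.\<close>

lemma join_map_cell:
  "join_map ` join_cell A {0..pi} \<subseteq> {x. x 3 \<ge> 0}"
  "join_map ` join_cell A {pi..2 * pi} \<subseteq> {x. x 3 \<le> 0}"
  "join_map ` join_cell A {0} \<subseteq> {x. x 3 = 0} \<inter> {x. x 2 \<ge> 0}"
  "join_map ` join_cell A {pi} \<subseteq> {x. x 3 = 0} \<inter> {x. x 2 \<le> 0}"
  "join_map ` join_cell A {} \<subseteq> {x. x 3 = 0} \<inter> {x. x 2 = 0}"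
  "join_map ` join_cell {0..pi} {} \<subseteq> {x. x 3 = 0} \<inter> {x. x 2 = 0} \<inter> {x. x 1 \<ge> 0}"
  "join_map ` join_cell {pi..2 * pi} {} \<subseteq> {x. x 3 = 0} \<inter> {x. x 2 = 0} \<inter> {x. x 1 \<le> 0}"
  "join_map ` join_cell {0} {} \<subseteq> {x. x 3 = 0} \<inter> {x. x 2 = 0} \<inter> {x. x 1 = 0}"
  "join_map ` join_cell {pi} {} \<subseteq> {x. x 3 = 0} \<inter> {x. x 2 = 0} \<inter> {x. x 1 = 0}"
proof -
  have pos: "0 < x 2 \<or> x 2 = 0" "0 < x 0 \<or> x 0 = 0" if "x \<in> join_cell A B" for A B x
    using that by (auto simp: join_cell_def)
  show "join_map ` join_cell A {0..pi} \<subseteq> {x. x 3 \<ge> 0}"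
  proof safe
    fix x assume "x \<in> join_cell A {0..pi}"
    then show "0 \<le> join_map x 3"
      using pos(1)[of x A "{0..pi}"] sin_ge_zero[of "x 3 / x 2"] by (auto simp: join_cell_def)
  qed
  show "join_map ` join_cell A {pi..2 * pi} \<subseteq> {x. x 3 \<le> 0}"
  proof safe
    fix x assume "x \<in> join_cell A {pi..2 * pi}"
    then show "join_map x 3 \<le> 0"
      using pos(1)[of x A "{pi..2 * pi}"] sin_le_0[of "x 3 / x 2"] by (auto simp: join_cell_def mult_le_0_iff)
  qed
  show "join_map ` join_cell A {0} \<subseteq> {x. x 3 = 0} \<inter> {x. x 2 \<ge> 0}"
  proof safe
    fix x assume "x \<in> join_cell A {0}"
    then show "join_map x 3 = 0" "0 \<le> join_map x 2"
      using pos(1)[of x A "{0}"] by (auto simp: join_cell_def)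
  qed
  show "join_map ` join_cell A {pi} \<subseteq> {x. x 3 = 0} \<inter> {x. x 2 \<le> 0}"
  proof safe
    fix x assume "x \<in> join_cell A {pi}"
    then show "join_map x 3 = 0" "join_map x 2 \<le> 0"
      using pos(1)[of x A "{pi}"] by (auto simp: join_cell_def)
  qed
  have empty: "x 2 = 0 \<and> x 0 = 1 \<and> x 1 \<in> A" if "x \<in> join_cell A {}" for x A
    using that by (auto simp: join_cell_def)
  show "join_map ` join_cell A {} \<subseteq> {x. x 3 = 0} \<inter> {x. x 2 = 0}"
    "join_map ` join_cell {0..pi} {} \<subseteq> {x. x 3 = 0} \<inter> {x. x 2 = 0} \<inter> {x. x 1 \<ge> 0}"
    "join_map ` join_cell {pi..2 * pi} {} \<subseteq> {x. x 3 = 0} \<inter> {x. x 2 = 0} \<inter> {x. x 1 \<le> 0}"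
    "join_map ` join_cell {0} {} \<subseteq> {x. x 3 = 0} \<inter> {x. x 2 = 0} \<inter> {x. x 1 = 0}"
    "join_map ` join_cell {pi} {} \<subseteq> {x. x 3 = 0} \<inter> {x. x 2 = 0} \<inter> {x. x 1 = 0}"
    by (auto dest!: empty simp: sin_ge_zero sin_le_0)
qed

text \<open>Three cuts lower the dimension: the 3-sphere splits into two halves, the 2-sphere
  between them into two discs, and their common circle into two half circles meeting in two points.
  Before the first and the last cut the \<open>p\<close> arcs are replaced by two half
  turns.\<close>

lemma not_homology_dvd_torus_join:
  assumes p: "0 < p" and m: "1 < m"
  shows "\<not> homology_dvd m 3 (nsphere 3) (torus_join p)"
proof
  let ?P = "\<lambda>a. join_simplex [fst_vertex a]" and ?A = "\<lambda>a b. join_simplex [fst_vertex a, fst_vertex b]"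
  let ?R = "\<lambda>a. ring_join p [a]" and ?W = "\<lambda>a b. ring_join p [a, b]"
  have S: "Suc 3 = 4" "Suc 2 = 3" "Suc 1 = 2" "Suc 0 = 1"
    by simp_all
  assume "homology_dvd m 3 (nsphere 3) (torus_join p)"
  moreover have "singular_relboundary 3 (nsphere 3) {} (?W b c - ?W a c + ?W a b)" for a b c
  proof -
    have "singular_chain 4 (nsphere 3) (ring_join p [a, b, c])"
      by (rule singular_chain_ring_join_nsphere) simp
    then show ?thesis
      unfolding singular_boundary S using chain_boundary_ring_join(4)[OF p, of a b c] by blast
  qed
  note concat = homologous_rel_concat[where W = ?W, OF this] and bd3 = this
  \<comment> \<open>The arcs of the second circle merge into one full turn, which is then split at
    \<open>pi\<close>.\<close>
  have "homologous_rel 3 (nsphere 3) {} (torus_join p) (?W 0 (2 * pi))"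
    using concat[where g = "\<lambda>j. 2 * pi * real j / p" and k = p] p by (simp add: torus_join_def)
  moreover have "homologous_rel 3 (nsphere 3) {} (?W 0 (2 * pi)) (?W 0 pi + ?W pi (2 * pi))"
    using bd3[of pi "2 * pi" 0] homologous_rel_sym[of 3 "nsphere 3" "{}" "?W 0 (2 * pi)"]
    by (simp add: homologous_rel_def algebra_simps)
  ultimately have "homology_dvd m 3 (nsphere 3) (?W 0 pi + ?W pi (2 * pi))"
    using homology_dvd_cong by blast
  moreover have "singular_chain 3 (subtopology (nsphere 3) {x. x 3 \<ge> 0}) (?W 0 pi)"
    by (rule singular_chain_ring_join[OF _ _ join_map_cell(1)]) auto
  moreover have "singular_chain 3 (subtopology (nsphere 3) {x. x 3 \<le> 0}) (?W pi (2 * pi))"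
    by (rule singular_chain_ring_join[OF _ _ join_map_cell(2)]) auto
  moreover have R0: "singular_chain 2 (subtopology (nsphere 2) {x. x 2 \<ge> 0}) (?R 0)"
    and Rpi: "singular_chain 2 (subtopology (nsphere 2) {x. x 2 \<le> 0}) (?R pi)"
    unfolding nsphere_2 subtopology_subtopology
    by (rule singular_chain_ring_join[OF _ _ join_map_cell(3)] singular_chain_ring_join[OF _ _ join_map_cell(4)]; simp)+
  moreover have "singular_chain 2 (nsphere 2) (chain_boundary 3 (?W 0 pi))"
    unfolding chain_boundary_ring_join(3)[OF p] using R0 Rpi
    by (intro singular_chain_diff) (simp_all add: singular_chain_subtopology)
  ultimately have "homology_dvd m 2 (nsphere 2) (?R pi - ?R 0)"
    using homology_dvd_nsphere_step[of 2 2 "?W 0 pi" "?W pi (2 * pi)" m, unfolded S]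
    unfolding chain_boundary_ring_join(3)[OF p] by blast
  \<comment> \<open>Rewritten so that the disc at angle 0, which lies in the upper hemisphere, comes
    first.\<close>
  then have "homology_dvd m 2 (nsphere 2) (- ?R 0 + ?R pi)"
    by simp
  moreover have "singular_chain 1 (nsphere 1) (chain_boundary 2 (- ?R 0))"
    unfolding chain_boundary_minus chain_boundary_ring_join(2)[OF p] singular_chain_minus nsphere_1
    by (rule singular_chain_ring_join[OF _ _ join_map_cell(5)]) auto
  moreover have "singular_chain 2 (subtopology (nsphere 2) {x. x 2 \<ge> 0}) (- ?R 0)"
    using R0 by (simp add: singular_chain_minus)
  ultimately have "homology_dvd m 1 (nsphere 1) (- ring_join p [])"
    using homology_dvd_nsphere_step[of 1 1 "- ?R 0" "?R pi" m, unfolded S] Rpi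
    unfolding chain_boundary_minus chain_boundary_ring_join(2)[OF p] by blast
  \<comment> \<open>The sign comes from the orientation of the upper disc and does not affect
    divisibility.\<close>
  then have "homology_dvd m 1 (nsphere 1) (ring_join p [])"
    unfolding homology_dvd_minus .
  moreover have "singular_relboundary 1 (nsphere 1) {} (?A b c - ?A a c + ?A a b)" for a b c
  proof -
    have "singular_chain 2 (nsphere 1) (join_simplex [fst_vertex a, fst_vertex b, fst_vertex c])"
      using singular_chain_join_simplex[of "[fst_vertex a, fst_vertex b, fst_vertex c]" UNIV "{}", OF _ _ _ _ join_map_cell(5)]
      by (simp add: nsphere_1[unfolded One_nat_def] numeral_2_eq_2)
    then show ?thesis
      unfolding singular_boundary S using chain_boundary_join_simplex(2) by blast
  qed
  note concat = homologous_rel_concat[where W = ?A, OF this] and bd1 = this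
  have "homologous_rel 1 (nsphere 1) {} (ring_join p []) (?A 0 (2 * pi))"
    using concat[where g = "\<lambda>j. 2 * pi * real j / p" and k = p] p by (simp add: ring_join_def)
  moreover have "homologous_rel 1 (nsphere 1) {} (?A 0 (2 * pi)) (?A 0 pi + ?A pi (2 * pi))"
    using bd1[of pi "2 * pi" 0] homologous_rel_sym[of 1 "nsphere 1" "{}" "?A 0 (2 * pi)"]
    by (simp add: homologous_rel_def algebra_simps)
  ultimately have "homology_dvd m 1 (nsphere 1) (?A 0 pi + ?A pi (2 * pi))"
    using homology_dvd_cong by blast
  moreover have "singular_chain 1 (subtopology (nsphere 1) {x. x 1 \<ge> 0}) (?A 0 pi)"
    "singular_chain 1 (subtopology (nsphere 1) {x. x 1 \<le> 0}) (?A pi (2 * pi))"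
    unfolding nsphere_1 subtopology_subtopology
    using singular_chain_join_simplex[of "[fst_vertex 0, fst_vertex pi]" "{0..pi}" "{}", OF _ _ _ _ join_map_cell(6)]
      singular_chain_join_simplex[of "[fst_vertex pi, fst_vertex (2 * pi)]" "{pi..2 * pi}" "{}", OF _ _ _ _ join_map_cell(7)]
    by simp_all
  moreover have "singular_chain 0 (nsphere 0) (chain_boundary 1 (?A 0 pi))"
    unfolding chain_boundary_join_simplex nsphere_0
    using singular_chain_join_simplex[of "[fst_vertex 0]" "{0}" "{}", OF _ _ _ _ join_map_cell(8)]
      singular_chain_join_simplex[of "[fst_vertex pi]" "{pi}" "{}", OF _ _ _ _ join_map_cell(9)]
    by (intro singular_chain_diff) simp_all
  ultimately have "homology_dvd m 0 (nsphere 0) (?P pi - ?P 0)"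
    using homology_dvd_nsphere_step[of 0 0 "?A 0 pi" "?A pi (2 * pi)" m, unfolded S]
    unfolding chain_boundary_join_simplex by blast
  moreover have "\<not> homology_dvd m 0 (nsphere 0) (?P pi - ?P 0)"
  proof -
    \<comment> \<open>The only point of the standard 0-simplex. There coordinate 0 of the two
      simplices is \<open>cos 0\<close> and \<open>cos pi\<close>, so they differ.\<close>
    let ?x = "(\<lambda>j. if j = 0 then 1 else 0) :: nat \<Rightarrow> real"
    let ?f = "\<lambda>a. simplex_map 0 join_map (oriented_simplex 0 ((!) [fst_vertex a]))"
    have "?f 0 ?x 0 \<noteq> ?f pi ?x 0"
      by (simp add: simplex_map_def oriented_simplex_def standard_simplex_0 fst_vertex_def)
    then have "?f 0 \<noteq> ?f pi"
      by metis
    then show ?thesis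
      using not_homology_dvd_nsphere_0[OF _ m] by (simp add: join_simplex_def)
  qed
  ultimately show False
    by blast
qed

section \<open>The degree of an equivariant map\<close>

lemma acyclic_in_nsphere:
  assumes "0 < n" "n \<noteq> k"
  shows "acyclic_in n (nsphere k)"
  unfolding acyclic_in_def
proof (intro allI impI)
  fix c assume c: "singular_relcycle n (nsphere k) {} c"
  have "trivial_group (homology_group (int n) (nsphere k))"
    using assms trivial_reduced_homology_group_nsphere[of "int n" k] by (simp add: un_reduced_homology_group)
  then have "carrier (homology_group (int n) (nsphere k)) = {singular_relboundary_set n (nsphere k) {}}"
    unfolding trivial_group_def by simp
  moreover have "homologous_rel_set n (nsphere k) {} c \<in> carrier (homology_group (int n) (nsphere k))"
    unfolding carrier_relative_homology_group by (rule imageI) (simp add: c)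
  ultimately have "homologous_rel_set n (nsphere k) {} c = singular_relboundary_set n (nsphere k) {}"
    by (simp only: singleton_iff)
  then show "singular_relboundary n (nsphere k) {} c"
    by (simp only: homologous_rel_set_eq_relboundary)
qed

text \<open>In positive dimension reduced and ordinary homology agree, so \<open>f\<close> raises
  homology classes to the power given by its degree; the power \<open>-1\<close> is the inverse,
  which is the negated coset.\<close>

lemma homologous_rel_chain_map_degree:
  assumes n: "0 < n" and f: "continuous_map (nsphere n) (nsphere n) f"
    and deg: "\<bar>Brouwer_degree2 n f\<bar> = 1" and z: "singular_relcycle n (nsphere n) {} z"
  shows "homologous_rel n (nsphere n) {} (chain_map n f z) z
       \<or> homologous_rel n (nsphere n) {} (chain_map n f z) (- z)"
proof -
  let ?X = "nsphere n" and ?d = "Brouwer_degree2 n f"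
  let ?G = "homology_group (int n) ?X" and ?c = "homologous_rel_set n ?X {} z"
  have G: "reduced_homology_group (int n) ?X = ?G"
    using n by (simp add: un_reduced_homology_group)
  have c: "?c \<in> carrier ?G"
    unfolding carrier_relative_homology_group by (rule imageI) (simp add: z)
  have "hom_induced (int n) ?X {} ?X {} f ?c = homologous_rel_set n ?X {} (chain_map n f z)"
    by (rule hom_induced_chain_map[OF f _ z]) simp
  then have eq: "homologous_rel_set n ?X {} (chain_map n f z) = ?c [^]\<^bsub>?G\<^esub> ?d"
    using Brouwer_degree2[of ?c n f] c unfolding G by simp
  interpret group ?G
    by simp
  from deg consider "?d = 1" | "?d = -1"
    by linarith
  then show ?thesis
  proof cases
    case 1
    then have "homologous_rel_set n ?X {} (chain_map n f z) = ?c"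
      using eq c by (simp add: int_pow_1)
    then show ?thesis
      unfolding homologous_rel_set_eq ..
  next
    case 2
    then have "homologous_rel_set n ?X {} (chain_map n f z) = inv\<^bsub>?G\<^esub> ?c"
      using eq c by (simp add: int_pow_neg int_pow_1)
    also have "\<dots> = uminus ` ?c"
      by (rule inv_relative_homology_group[OF c])
    finally have "chain_map n f z \<in> uminus ` ?c"
      using homologous_rel_refl by blast
    then obtain w where w: "homologous_rel n ?X {} z w" "chain_map n f z = - w"
      by auto
    then have "homologous_rel n ?X {} (chain_map n f z) (- z)"
      using homologous_rel_diff[OF homologous_rel_refl[of n ?X "{}" 0] w(1)] homologous_rel_sym by fastforce
    then show ?thesis ..
  qed
qed

text \<open>The boundary telescopes to the difference of the discs at the angles
  \<open>2 * pi\<close> and 0, which are the same chain.\<close>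

lemma singular_cycle_torus_join:
  assumes p: "0 < p"
  shows "singular_relcycle 3 (nsphere 3) {} (torus_join p)"
proof -
  have "join_simplex (fst_vertex t # fst_vertex u # map snd_vertex [2 * pi])
      = join_simplex (fst_vertex t # fst_vertex u # map snd_vertex [0])" for t u
    using join_simplex_periodic[of 0 "2 * pi" "fst_vertex t # fst_vertex u # map snd_vertex [0]"] by simp
  then have "ring_join p [2 * pi] = ring_join p [0]"
    unfolding ring_join_def by simp
  moreover have "chain_boundary 3 (torus_join p)
      = (\<Sum>j<p. ring_join p [2 * pi * real (Suc j) / p] - ring_join p [2 * pi * real j / p])"
    unfolding torus_join_def chain_boundary_sum o_def chain_boundary_ring_join(3)[OF p] ..
  moreover have "\<dots> = ring_join p [2 * pi] - ring_join p [0]"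
    using sum_lessThan_telescope[of "\<lambda>j. ring_join p [2 * pi * real j / p]" p] p by simp
  ultimately have "chain_boundary 3 (torus_join p) = 0"
    by simp
  moreover have "singular_chain 3 (nsphere 3) (torus_join p)"
    unfolding torus_join_def by (intro singular_chain_sum singular_chain_ring_join_nsphere) simp
  ultimately show ?thesis
    by (simp add: singular_cycle)
qed

lemma path_connected_space_nsphere_3: "path_connected_space (nsphere 3)"
proof -
  have "path_connected (sphere (0 :: complex \<times> complex) 1)"
    by (simp add: simply_connected_imp_path_connected simply_connected_sphere)
  then show ?thesis
    using homeomorphic_path_connected_space[OF homeomorphic_maps_imp_homeomorphic_space[OF homeomorphic_maps_sphere_coords]]
    by simp
qed

lemma rotation_funpow_sphere_coords:
  "(rotation (2 * pi / p) (2 * pi * q / p) ^^ k) (sphere_coords y) = sphere_coords (lens_action p q (int k) y)"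
proof (induction k)
  case (Suc k)
  have "rotation (2 * pi / p) (2 * pi * q / p) (sphere_coords x) = sphere_coords (lens_action p q 1 x)" for x
    by (simp add: rotation_def lens_action_def case_prod_unfold Complex.DeMoivre mult_ac)
  then show ?case
    using Suc lens_action_add[of p q 1 "int k" y] by simp
qed (simp add: lens_action_0)

text \<open>With \<open>u * k + v * m = 1\<close>, the chain \<open>z\<close> is the sum of its
  multiples by \<open>u * k\<close> and \<open>v * m\<close>, and the first is homologous to
  \<open>m\<close> times the multiple of \<open>y\<close> by \<open>u\<close>.\<close>

lemma homology_dvd_of_cmul:
  assumes z: "singular_relcycle n X {} z" and y: "singular_relcycle n X {} y"
    and eq: "homologous_rel n X {} (frag_cmul k z) (frag_cmul m y)" and cop: "coprime k m"
  shows "homology_dvd m n X z"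
proof -
  obtain u v where uv: "u * k + v * m = 1"
    using bezout_int[of k m] cop by (metis coprime_imp_gcd_eq_1)
  have "homologous_rel n X {} (frag_cmul u (frag_cmul k z)) (frag_cmul u (frag_cmul m y))"
    using singular_relboundary_cmul[of n X "{}" "frag_cmul k z - frag_cmul m y" u] eq
    by (simp add: homologous_rel_def frag_cmul_diff_distrib2)
  then have "homologous_rel n X {} (frag_cmul u (frag_cmul k z) + frag_cmul (v * m) z)
      (frag_cmul u (frag_cmul m y) + frag_cmul (v * m) z)"
    by (intro homologous_rel_add homologous_rel_refl)
  moreover have "frag_cmul u (frag_cmul k z) + frag_cmul (v * m) z = z"
    using uv by (simp flip: frag_cmul_distrib)
  moreover have "frag_cmul u (frag_cmul m y) + frag_cmul (v * m) z = frag_cmul m (frag_cmul u y + frag_cmul v z)"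
    by (simp add: frag_cmul_distrib2 mult.commute)
  ultimately have "homologous_rel n X {} z (frag_cmul m (frag_cmul u y + frag_cmul v z))"
    by simp
  moreover have "singular_relcycle n X {} (frag_cmul u y + frag_cmul v z)"
    by (intro singular_relcycle_add singular_relcycle_cmul z y)
  ultimately show ?thesis
    unfolding homology_dvd_def by blast
qed

text \<open>The image under \<open>F\<close> of the tower for \<open>q\<close> and the
  \<open>a\<close>-th power of the tower for \<open>q'\<close> belong to the same map, so
  \<open>q F(e)\<close> and \<open>a^2 q' e\<close> agree modulo \<open>p\<close>. As
  \<open>F(e)\<close> is \<open>e\<close> or \<open>-e\<close> up to boundaries, a coefficient
  coprime to \<open>p\<close> would make \<open>e\<close> divisible by \<open>p\<close>.\<close>

lemma lens_space_degree_cong: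
  assumes p: "1 < p"
    and F: "continuous_map (top_of_set (sphere 0 1)) (top_of_set (sphere 0 1)) F"
    and G: "continuous_map (top_of_set (sphere 0 1)) (top_of_set (sphere 0 1)) G"
    and equiv: "\<And>x. x \<in> sphere 0 1 \<Longrightarrow> F (lens_action p q 1 x) = lens_action p q' (int a) (F x)"
    and FG: "homotopic_with_canon (\<lambda>x. True) (sphere 0 1) (sphere 0 1) (F \<circ> G) id"
  shows "\<exists>\<epsilon> \<in> {1, -1}. \<not> coprime (\<epsilon> * int q - int (a * a) * int q') (int p)"
proof -
  let ?S = "top_of_set (sphere (0 :: complex \<times> complex) 1)" and ?X = "nsphere 3"
  let ?T = "rotation (2 * pi / p) (2 * pi * q / p)" and ?T' = "rotation (2 * pi / p) (2 * pi * q' / p)"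
  have p0: "0 < p" using p by simp
  have h: "continuous_map ?S ?X sphere_coords" and k: "continuous_map ?X ?S sphere_point"
    and hk: "\<And>x. x \<in> topspace ?X \<Longrightarrow> sphere_coords (sphere_point x) = x"
    using homeomorphic_maps_sphere_coords by (auto simp: homeomorphic_maps_def)
  \<comment> \<open>Transports self-maps of the unit sphere of pairs of complex numbers to
    \<open>nsphere 3\<close>.\<close>
  define conj :: "(complex \<times> complex \<Rightarrow> complex \<times> complex) \<Rightarrow> _"
    where "conj = (\<lambda>f. sphere_coords \<circ> (f \<circ> sphere_point))"
  have conj: "continuous_map ?X ?X (conj f)" if "continuous_map ?S ?S f" for f
    unfolding conj_def by (intro continuous_map_compose[OF k] continuous_map_compose[OF _ h] that continuous_map_compose[OF k that])
  have conj_hom: "homotopic_with (\<lambda>x. True) ?X ?X (conj f) id"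
    if "homotopic_with (\<lambda>x. True) ?S ?S f id" for f
  proof -
    have "homotopic_with (\<lambda>x. True) ?X ?X (conj f) (conj id)"
      unfolding conj_def
      by (intro homotopic_with_compose_continuous_map_left[OF _ h]
          homotopic_with_compose_continuous_map_right[OF that k]) (rule TrueI)+
    moreover have "homotopic_with (\<lambda>x. True) ?X ?X (conj id) id"
      by (rule homotopic_with_equal) (simp_all add: conj, simp add: conj_def hk)
    ultimately show ?thesis
      by (rule homotopic_with_trans)
  qed
  have act: "continuous_map ?S ?S (lens_action p r j)" for r j
    by (auto simp: continuous_on_lens_action norm_lens_action)
  have T_conj: "(rotation (2 * pi / p) (2 * pi * r / p) ^^ j) x = conj (lens_action p r (int j)) x"
    if "x \<in> topspace ?X" for r j x
    using rotation_funpow_sphere_coords[where q = r and k = j and y = "sphere_point x"] hk[OF that]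
    by (simp add: conj_def)
  have T_cont: "continuous_map ?X ?X (rotation (2 * pi / p) (2 * pi * r / p) ^^ j)" for r j :: nat
    by (rule continuous_map_eq[OF conj[OF act[of r "int j"]]]) (simp add: T_conj)
  have T_per: "(rotation (2 * pi / p) (2 * pi * r / p) ^^ p) x = x" if "x \<in> topspace ?X" for r :: nat and x
    using T_conj[where r = r and j = p, OF that] lens_action_period[OF p0, where q = r and k = 0] hk[OF that]
    by (simp add: conj_def lens_action_0)
  have T_hom: "homotopic_with (\<lambda>x. True) ?X ?X (rotation (2 * pi / p) (2 * pi * r / p) ^^ j) id" for r j :: nat
  proof (rule homotopic_with_trans)
    show "homotopic_with (\<lambda>x. True) ?X ?X (rotation (2 * pi / p) (2 * pi * r / p) ^^ j) (conj (lens_action p r (int j)))"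
      by (rule homotopic_with_equal) (use T_cont T_conj in auto)
  qed (rule conj_hom[OF homotopic_lens_action_id])
  define s where "s = ?T' ^^ a"
  have s: "continuous_map ?X ?X s"
    unfolding s_def by (rule T_cont)
  have s_per: "(s ^^ p) x = x" if "x \<in> topspace ?X" for x
  proof -
    have "((?T' ^^ p) ^^ i) x = x" for i
      by (induction i) (simp_all add: T_per[OF that])
    then show ?thesis
      unfolding s_def funpow_mult by (metis funpow_mult mult.commute)
  qed
  have s_hom: "homotopic_with (\<lambda>x. True) ?X ?X (s ^^ i) id" for i
    unfolding s_def funpow_mult by (rule T_hom)
  have FT: "conj F (?T x) = s (conj F x)" if "x \<in> topspace ?X" for x
  proof -
    have y: "sphere_point x \<in> sphere 0 1"
      using continuous_map_funspace[OF k] that by auto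
    have "?T x = sphere_coords (lens_action p q 1 (sphere_point x))"
      using T_conj[where r = q and j = 1, OF that] by (simp add: conj_def)
    then have "conj F (?T x) = sphere_coords (F (lens_action p q 1 (sphere_point x)))"
      by (simp add: conj_def)
    also have "\<dots> = sphere_coords (lens_action p q' (int a) (F (sphere_point x)))"
      using equiv[OF y] by simp
    also have "\<dots> = s (conj F x)"
      unfolding s_def conj_def by (simp add: rotation_funpow_sphere_coords)
    finally show ?thesis .
  qed
  let ?e = "torus_join p" and ?c0 = "join_simplex [fst_vertex 0]"
  note T1 = lens_tower_rotation[OF p0, of q] and T2 = lens_tower_rotation[OF p0, of q']
  let ?c1 = "join_simplex [fst_vertex 0, fst_vertex (2 * pi / p)]" and ?c2 = "ring_join p [0]"
  let ?c3 = "\<lambda>r. \<Sum>j<r. ring_join p [2 * pi * real j / p, 2 * pi * real (Suc j) / p]"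
  have U1: "lens_tower ?X s p (chain_map 0 (conj F) ?c0) (chain_map 1 (conj F) ?c1)
      (chain_map 2 (conj F) ?c2) (chain_map 3 (conj F) (?c3 q))"
    and U1': "orbit_sum 3 s p (chain_map 3 (conj F) (?c3 q)) = frag_cmul (int q) (chain_map 3 (conj F) ?e)"
    using lens_tower_natural[where s' = s, OF conj[OF F] T_cont[where r = q and j = 1, simplified] FT T1(1)]
    by (simp_all only: T1(2) chain_map_cmul)
  have U2: "lens_tower ?X s p ?c0 (orbit_sum 1 ?T' a ?c1) (frag_cmul (int a) ?c2)
      (frag_cmul (int a) (orbit_sum 3 ?T' a (?c3 q')))"
    and U2': "orbit_sum 3 s p (frag_cmul (int a) (orbit_sum 3 ?T' a (?c3 q')))
      = frag_cmul (int (a * a) * int q') ?e"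
    using lens_tower_funpow[OF T_cont[where r = q' and j = 1, simplified] T_per T2(1), of a] unfolding s_def
    by (simp_all only: T2(2) frag_cmul_cmul)
  \<comment> \<open>Any two 0-simplices of a path-connected space are homologous.\<close>
  obtain b where b: "singular_chain 1 ?X b" "chain_boundary 1 b = chain_map 0 (conj F) ?c0 - ?c0"
  proof -
    have "singular_chain 0 ?X ?c0" "singular_chain 0 ?X (chain_map 0 (conj F) ?c0)"
      using U1 U2 unfolding lens_tower_def by blast+
    moreover have "?c0 = frag_of (simplex_map 0 join_map (oriented_simplex 0 ((!) [fst_vertex 0])))"
      by (simp add: join_simplex_def)
    ultimately have "homologous_rel 0 ?X {} (chain_map 0 (conj F) ?c0) ?c0"
      by (simp add: singular_chain_of iso_integer_zeroth_homology_group_aux[OF path_connected_space_nsphere_3])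
    then show thesis
      using that unfolding homologous_rel_def singular_boundary One_nat_def by blast
  qed
  have acyc: "acyclic_in 1 ?X" "acyclic_in 2 ?X"
    by (rule acyclic_in_nsphere; simp)+
  obtain e where e: "singular_relcycle 3 ?X {} e"
    "homologous_rel 3 ?X {} (orbit_sum 3 s p (chain_map 3 (conj F) (?c3 q))
       - orbit_sum 3 s p (frag_cmul (int a) (orbit_sum 3 ?T' a (?c3 q')))) (frag_cmul (int p) e)"
    by (rule lens_tower_unique[OF s _ s_hom acyc b U2 U1]) (assumption | rule s_per that)+
  have "homotopic_with (\<lambda>x. True) ?X ?X (conj F \<circ> conj G) id"
    using conj_hom[OF FG] by (simp add: conj_def comp_def)
  \<comment> \<open>Degrees multiply under composition, and the identity has degree 1.\<close>
  then have "\<bar>Brouwer_degree2 3 (conj F)\<bar> = 1"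
    by (rule Brouwer_degree2_homotopy_equivalence[OF conj[OF F] conj[OF G]])
  then have "homologous_rel 3 ?X {} (chain_map 3 (conj F) ?e) ?e \<or> homologous_rel 3 ?X {} (chain_map 3 (conj F) ?e) (- ?e)"
    by (rule homologous_rel_chain_map_degree[OF _ conj[OF F] _ singular_cycle_torus_join[OF p0], rotated]) simp
  then have "\<exists>\<epsilon> \<in> {1, -1}. homologous_rel 3 ?X {} (chain_map 3 (conj F) ?e) (frag_cmul \<epsilon> ?e)"
    by simp
  then obtain \<epsilon> :: int where \<epsilon>: "\<epsilon> \<in> {1, -1}" "homologous_rel 3 ?X {} (chain_map 3 (conj F) ?e) (frag_cmul \<epsilon> ?e)" ..
  have "homologous_rel 3 ?X {} (frag_cmul (int q) (chain_map 3 (conj F) ?e)) (frag_cmul (int q) (frag_cmul \<epsilon> ?e))"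
    using singular_relboundary_cmul[of 3 ?X "{}" "chain_map 3 (conj F) ?e - frag_cmul \<epsilon> ?e" "int q"] \<epsilon>(2)
    by (simp only: homologous_rel_def frag_cmul_diff_distrib2)
  then have "homologous_rel 3 ?X {} (frag_cmul (int q) (frag_cmul \<epsilon> ?e) - frag_cmul (int (a * a) * int q') ?e) (frag_cmul (int p) e)"
    using homologous_rel_trans[OF e(2)[unfolded U1' U2'] homologous_rel_diff[OF _ homologous_rel_refl]] homologous_rel_sym by blast
  then have "homologous_rel 3 ?X {} (frag_cmul (\<epsilon> * int q - int (a * a) * int q') ?e) (frag_cmul (int p) e)"
    by (simp add: frag_cmul_diff_distrib mult.commute)
  then have "\<not> coprime (\<epsilon> * int q - int (a * a) * int q') (int p)"
    using homology_dvd_of_cmul[OF singular_cycle_torus_join[OF p0] e(1)] not_homology_dvd_torus_join[OF p0, of "int p"] p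
    by auto
  then show ?thesis
    using \<epsilon>(1) by blast
qed

section \<open>The congruence between the parameters\<close>

theorem corollary2p23:
  fixes p q q' :: nat
  assumes "prime p" and "p \<noteq> 2"
    and "1 \<le> q" and "q < p" and "1 \<le> q'" and "q' < p"
    and "lens_space p q homotopy_equivalent_space lens_space p q'"
  shows "\<exists>n \<in> {1..<int p}. [int q * int q' = n\<^sup>2] (mod int p) \<or>
                            [int q * int q' = - (n\<^sup>2)] (mod int p)"
proof -
  have p: "1 < p" "prime (int p)"
    using assms(1) prime_gt_1_nat by auto
  obtain F G and a :: nat where
    "continuous_map (top_of_set (sphere 0 1)) (top_of_set (sphere 0 1)) F"
    "continuous_map (top_of_set (sphere 0 1)) (top_of_set (sphere 0 1)) G"
    "\<And>x. x \<in> sphere 0 1 \<Longrightarrow> F (lens_action p q 1 x) = lens_action p q' (int a) (F x)"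
    "homotopic_with_canon (\<lambda>x. True) (sphere 0 1) (sphere 0 1) (F \<circ> G) id"
    by (rule lens_space_homotopy_equivalence_lift[OF assms(1,3-7)]) (rule that)
  then obtain \<epsilon> :: int where \<epsilon>: "\<epsilon> = 1 \<or> \<epsilon> = -1" "\<not> coprime (\<epsilon> * int q - int (a * a) * int q') (int p)"
    using lens_space_degree_cong[OF p(1)] by (metis insertE singletonD)
  then have dvd: "int p dvd \<epsilon> * int q - int (a * a) * int q'"
    using p(2) prime_imp_coprime coprime_commute by blast
  have nq: "\<not> int p dvd int q"
    using assms(3,4) by (auto dest: dvd_imp_le)
  \<comment> \<open>If \<open>p\<close> divided \<open>a\<close>, the divisibility just found would
    make it divide \<open>q\<close>.\<close>
  have na: "\<not> int p dvd int a"
  proof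
    assume "int p dvd int a"
    then have "int p dvd int (a * a) * int q'"
      by simp
    then have "int p dvd \<epsilon> * int q"
      using dvd_add[OF dvd] by fastforce
    then show False
      using \<epsilon>(1) nq by auto
  qed
  then have "coprime (int a) (int p)"
    using p(2) prime_imp_coprime coprime_commute by blast
  then obtain b where b: "[int a * b = 1] (mod int p)"
    using cong_solve_coprime_int by blast
  \<comment> \<open>As \<open>b\<close> is inverse to \<open>a\<close>, this is \<open>q / a\<close>
    modulo \<open>p\<close>; its square is \<open>\<epsilon> * q * q'\<close>, because
    \<open>\<epsilon> * q\<close> is congruent to \<open>a^2 * q'\<close>.\<close>
  define n where "n = (int q * b) mod int p"
  have n: "[n = int q * b] (mod int p)"
    by (simp add: n_def cong_def)
  have "\<not> int p dvd b"
  proof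
    assume "int p dvd b"
    then have "int p dvd int a * b"
      by simp
    moreover have "int p dvd int a * b - 1"
      using b by (simp add: cong_iff_dvd_diff)
    ultimately have "int p dvd int a * b - (int a * b - 1)"
      by (rule dvd_diff)
    then show False
      using p(1) by simp
  qed
  then have "\<not> int p dvd int q * b"
    using nq p(2) prime_dvd_mult_iff by blast
  then have "n \<in> {1..<int p}"
  proof -
    assume "\<not> int p dvd int q * b"
    then have "n \<noteq> 0"
      by (simp add: n_def dvd_eq_mod_eq_0)
    moreover have "0 \<le> n" "n < int p"
      using p(1) by (simp_all add: n_def)
    ultimately show ?thesis
      by simp
  qed
  have "[\<epsilon> * int q = int a * int a * int q'] (mod int p)"
    using dvd by (simp add: cong_iff_dvd_diff)
  \<comment> \<open>Multiplying by \<open>q * b^2\<close> completes the square on the left, and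
    since \<open>a * b\<close> is congruent to 1 it leaves \<open>q * q'\<close> on the
    right.\<close>
  then have "[(\<epsilon> * int q) * (int q * b * b) = (int a * int a * int q') * (int q * b * b)] (mod int p)"
    by (rule cong_scalar_right)
  moreover have "[(int a * b) * (int a * b) * (int q * int q') = 1 * 1 * (int q * int q')] (mod int p)"
    by (intro cong_mult b cong_refl)
  ultimately have "[\<epsilon> * (int q * b)\<^sup>2 = int q * int q'] (mod int p)"
    by (simp add: power2_eq_square mult_ac cong_def)
  moreover have "[\<epsilon> * n\<^sup>2 = \<epsilon> * (int q * b)\<^sup>2] (mod int p)"
    by (intro cong_mult cong_refl cong_pow n)
  ultimately have "[int q * int q' = \<epsilon> * n\<^sup>2] (mod int p)"
    by (metis cong_sym cong_trans)
  then show ?thesis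
    using \<epsilon>(1) \<open>n \<in> {1..<int p}\<close> by auto
qed

end
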